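(* There is a randomized Congested Clique algorithm that finds a $2$-ruling set of the input graph; the algorithm runs in $O(1)$ rounds with high probability.
   Context: A $2$-ruling set of a graph $G=(V,E)$ is a set $S\subseteq V$ of pairwise non-adjacent vertices such that every vertex is within distance at most $2$ of some vertex of $S$. In the Congested Clique model, each of the $n$ vertices of the input graph is a machine that initially knows its incident edges; computation proceeds in synchronous rounds in which every pair of machines may exchange a message of $O(\log n)$ bits. "With high probability" means with probability at least $1-1/n^{c'}$ for a constant $c'\ge1$ that can be chosen. *)

theory Defs
  imports
    "HOL-Probability.Product_PMF"
    "Graph_Theory.Pair_Digraph"
    "Graph_Theory.Shortest_Path"
begin

section \<open>2-ruling sets\<close>

text \<open>Simple undirected graphs are instances of \<^locale>\<open>pair_graph\<close>: finite, symmetric, loop-free.\<close>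

definition graph_dist :: "'a pair_pre_digraph \<Rightarrow> 'a \<Rightarrow> 'a \<Rightarrow> ereal" where
  "graph_dist G u v = wf_digraph.\<mu> (with_proj G) (\<lambda>_. 1) u v"

definition two_ruling_set :: "'a pair_pre_digraph \<Rightarrow> 'a set \<Rightarrow> bool" where
  "two_ruling_set G S \<longleftrightarrow>
     S \<subseteq> pverts G \<and>
     (\<forall>u\<in>S. \<forall>v\<in>S. u \<noteq> v \<longrightarrow> (u, v) \<notin> parcs G) \<and>
     (\<forall>v\<in>pverts G. \<exists>s\<in>S. graph_dist G v s \<le> 2)"


section \<open>The randomized Congested Clique\<close>

text \<open>
  Every machine runs the same program. A machine starts from \<open>cc_init n v N\<close>, given the number of
  machines, its own identifier and the set of its neighbours. In every round a machine in state
  \<open>s\<close> sends the bit string \<open>cc_send s u\<close> to each other machine \<open>u\<close>; with \<open>m u\<close> the string received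
  from \<open>u\<close>, its next state is drawn from \<open>cc_recv s m\<close>. Local computation is not restricted, and
  private randomness enters through the distributions of the local states.
  A machine has halted once \<open>cc_output\<close> is \<^term>\<open>Some b\<close>, where \<open>b\<close> tells whether it joins the set
  that is computed.
\<close>

record 's cc_algorithm =
  cc_init :: "nat \<Rightarrow> nat \<Rightarrow> nat set \<Rightarrow> 's pmf"
  cc_send :: "'s \<Rightarrow> nat \<Rightarrow> bool list"
  cc_recv :: "'s \<Rightarrow> (nat \<Rightarrow> bool list) \<Rightarrow> 's pmf"
  cc_output :: "'s \<Rightarrow> bool option"

definition cc_input :: "nat \<Rightarrow> nat pair_pre_digraph \<Rightarrow> bool" where
  "cc_input n G \<longleftrightarrow> pair_graph G \<and> pverts G = {..<n}"

definition cc_halted :: "'s cc_algorithm \<Rightarrow> 's \<Rightarrow> bool" where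
  "cc_halted A s \<longleftrightarrow> cc_output A s \<noteq> None"

text \<open>
  \<open>cc_inbox A n \<sigma> v u\<close> is the message from \<open>u\<close> to \<open>v\<close>. The empty string stands for no message;
  halted machines are silent.
\<close>

definition cc_inbox :: "'s cc_algorithm \<Rightarrow> nat \<Rightarrow> (nat \<Rightarrow> 's) \<Rightarrow> nat \<Rightarrow> nat \<Rightarrow> bool list" where
  "cc_inbox A n \<sigma> v u =
     (if u < n \<and> u \<noteq> v \<and> \<not> cc_halted A (\<sigma> u) then cc_send A (\<sigma> u) v else [])"

text \<open>
  The product distributions express that distinct machines use independent randomness. The state
  of a halted machine is frozen, so its output is final.
\<close>

definition cc_round :: "'s cc_algorithm \<Rightarrow> nat \<Rightarrow> (nat \<Rightarrow> 's) \<Rightarrow> (nat \<Rightarrow> 's) pmf" where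
  "cc_round A n \<sigma> = Pi_pmf {..<n} undefined
     (\<lambda>v. if cc_halted A (\<sigma> v) then return_pmf (\<sigma> v)
          else cc_recv A (\<sigma> v) (cc_inbox A n \<sigma> v))"

primrec cc_run :: "'s cc_algorithm \<Rightarrow> nat \<Rightarrow> nat pair_pre_digraph \<Rightarrow> nat \<Rightarrow> (nat \<Rightarrow> 's) pmf" where
  "cc_run A n G 0 = Pi_pmf {..<n} undefined (\<lambda>v. cc_init A n v {u. (v, u) \<in> parcs G})"
| "cc_run A n G (Suc t) = bind_pmf (cc_run A n G t) (cc_round A n)"

definition cc_all_halted :: "'s cc_algorithm \<Rightarrow> nat \<Rightarrow> (nat \<Rightarrow> 's) \<Rightarrow> bool" where
  "cc_all_halted A n \<sigma> \<longleftrightarrow> (\<forall>v<n. cc_halted A (\<sigma> v))"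

definition cc_result :: "'s cc_algorithm \<Rightarrow> nat \<Rightarrow> (nat \<Rightarrow> 's) \<Rightarrow> nat set" where
  "cc_result A n \<sigma> = {v. v < n \<and> cc_output A (\<sigma> v) = Some True}"

text \<open>
  The probability that the running time is at most \<open>t\<close>: since halted states are frozen, this is
  the probability that all machines have halted in the configuration after round \<open>t\<close>.
\<close>

definition cc_prob_halted ::
    "'s cc_algorithm \<Rightarrow> nat \<Rightarrow> nat pair_pre_digraph \<Rightarrow> nat \<Rightarrow> real" where
  "cc_prob_halted A n G t = measure_pmf.prob (cc_run A n G t) {\<sigma>. cc_all_halted A n \<sigma>}"

text \<open>Every message has \<open>O(log n)\<close> bits, in every configuration that can arise in an execution.\<close>

definition cc_log_bandwidth :: "'s cc_algorithm \<Rightarrow> bool" where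
  "cc_log_bandwidth A \<longleftrightarrow>
     (\<exists>C::real. \<forall>n G t. cc_input n G \<longrightarrow>
        (\<forall>\<sigma>\<in>set_pmf (cc_run A n G t). \<forall>u<n. \<forall>v<n.
           real (length (cc_inbox A n \<sigma> v u)) \<le> C * log 2 (real n)))"

text \<open>
  The algorithm is of Las Vegas type: it halts with probability 1 (the events ``halted by round
  \<open>t\<close>'' increase with \<open>t\<close>), and then its result is always correct.
\<close>

definition cc_finds ::
    "'s cc_algorithm \<Rightarrow> (nat pair_pre_digraph \<Rightarrow> nat set \<Rightarrow> bool) \<Rightarrow> bool" where
  "cc_finds A P \<longleftrightarrow>
     (\<forall>n G. cc_input n G \<longrightarrow>
        cc_prob_halted A n G \<longlonglongrightarrow> 1 \<and>
        (\<forall>t. \<forall>\<sigma>\<in>set_pmf (cc_run A n G t). cc_all_halted A n \<sigma> \<longrightarrow> P G (cc_result A n \<sigma>)))"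

text \<open>
  The exponent \<open>c\<close> of the failure probability can be chosen arbitrarily; the round bound \<open>R\<close> may
  depend on it, but neither on \<open>n\<close> nor on the input graph.
\<close>

definition cc_constant_rounds_whp :: "'s cc_algorithm \<Rightarrow> bool" where
  "cc_constant_rounds_whp A \<longleftrightarrow>
     (\<forall>c::real. c \<ge> 1 \<longrightarrow>
        (\<exists>R. \<forall>n G. cc_input n G \<longrightarrow> cc_prob_halted A n G R \<ge> 1 - 1 / real n powr c))"

text \<open>
  Natural numbers can serve as local states without loss of generality: inputs, messages
  and the supports of the distributions are finite or countable, so only countably many local
  states are reachable.
\<close>

end

theory Submission
  imports Defs "HOL-Computational_Algebra.Nth_Powers"
begin

text \<open>
  The algorithm is a derandomized version of the sampling approach to 2-ruling sets.

  Since local computation is free, a quantity counts as computed once it is a function of values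
  that the machines have announced to everybody. \<open>O(n)\<close> edges can be made public in a constant
  number of rounds, and so can a maximal independent set of a subgraph with \<open>O(n)\<close> edges. A random
  choice may be replaced by a fixed one as long as its cost is a sum of terms that single machines
  can evaluate: a polynomial number of samples represents the distribution well enough for all
  neighbourhoods at once, and the best of them is found digit by digit with the method of
  conditional expectations.

  Let \<open>b v\<close> be the 34th root of the degree of \<open>v\<close>, and call \<open>v\<close> bad if the sum of \<open>b u ^ (-17)\<close>
  over its neighbours \<open>u\<close> is less than \<open>b v\<close>. Four independent sets are chosen, each among the
  vertices that are at distance more than two from the earlier ones.

  First, sampling with probabilities \<open>b v ^ (-17)\<close> gives \<open>O(n)\<close> edges, and the good vertices
  without a sampled neighbour have only \<open>O(n)\<close> incident edges. Second, remaining bad vertices are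
  sampled with probabilities \<open>b v ^ (-25)\<close>; a sampled bad vertex hardly ever has a sampled neighbour
  of at least the same degree, so it can be chosen directly. A vertex with many bad neighbours of
  the same degree class is thus likely to be dominated, which rules all of them; therefore the
  sum of \<open>b v ^ 6\<close> over the bad vertices that remain is \<open>O(n)\<close>. Third, sampling these with
  probabilities \<open>b v ^ (-6)\<close> leaves \<open>O(n)\<close> edges among the bad vertices that are still not
  dominated. Fourth, all remaining edges are made public.
\<close>

section \<open>Rounds with public announcements\<close>

text \<open>Symmetry makes \<open>N v\<close> empty for every \<open>v\<close> outside
  \<open>{..<n}\<close>: a member \<open>u\<close> would have \<open>v \<in> N u\<close> and hence
  \<open>v < n\<close>.\<close>

definition graph_on :: "nat \<Rightarrow> (nat \<Rightarrow> nat set) \<Rightarrow> bool" where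
  "graph_on n N \<longleftrightarrow> (\<forall>u v. u \<in> N v \<longrightarrow> u < n \<and> v \<in> N u \<and> u \<noteq> v)"

type_synonym send_rule = "nat \<Rightarrow> (nat \<Rightarrow> nat) list \<Rightarrow> nat set \<Rightarrow> nat \<Rightarrow> nat \<Rightarrow> nat"
type_synonym publish_rule =
  "nat \<Rightarrow> (nat \<Rightarrow> nat) list \<Rightarrow> nat set \<Rightarrow> nat \<Rightarrow> (nat \<Rightarrow> nat) \<Rightarrow> nat"

text \<open>
  In every round, machine \<open>v\<close> sends a private number to each machine \<open>u\<close>, and then \<open>u\<close> announces
  one number to all. The list \<open>C\<close> of the announcements so far is common knowledge.
\<close>

definition received ::
    "send_rule \<Rightarrow> nat \<Rightarrow> (nat \<Rightarrow> nat set) \<Rightarrow> (nat \<Rightarrow> nat) list \<Rightarrow> nat \<Rightarrow> nat \<Rightarrow> nat" where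
  "received send n N C u = (\<lambda>v. if u < n \<and> v < n then send n C (N v) v u else 0)"

definition published ::
    "send_rule \<Rightarrow> publish_rule \<Rightarrow> nat \<Rightarrow> (nat \<Rightarrow> nat set) \<Rightarrow> (nat \<Rightarrow> nat) list \<Rightarrow> nat \<Rightarrow> nat" where
  "published send pub n N C =
     (\<lambda>u. if u < n then pub n C (N u) u (received send n N C u) else 0)"

primrec transcript ::
    "send_rule \<Rightarrow> publish_rule \<Rightarrow> nat \<Rightarrow> (nat \<Rightarrow> nat set) \<Rightarrow> nat \<Rightarrow> (nat \<Rightarrow> nat) list" where
  "transcript send pub n N 0 = []"
| "transcript send pub n N (Suc t) =
     transcript send pub n N t @ [published send pub n N (transcript send pub n N t)]"

definition bounded_rounds ::
    "send_rule \<Rightarrow> publish_rule \<Rightarrow> nat \<Rightarrow> nat \<Rightarrow> nat \<Rightarrow> (nat \<Rightarrow> nat set) \<Rightarrow> bool" where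
  "bounded_rounds send pub R K n N \<longleftrightarrow> (\<forall>t<R. \<forall>u v.
     received send n N (transcript send pub n N t) u v < (n + 1) ^ K \<and>
     published send pub n N (transcript send pub n N t) u < (n + 1) ^ K)"

text \<open>A value of this kind is known to every machine after \<open>R\<close> rounds.
  \<open>R\<close> and \<open>K\<close> are chosen before \<open>n\<close> and \<open>N\<close>,
  which keeps the number of rounds constant and the messages logarithmic; \<open>h\<close> is
  arbitrary because local computation is free.\<close>

definition computable :: "(nat \<Rightarrow> (nat \<Rightarrow> nat set) \<Rightarrow> 'a) \<Rightarrow> bool" where
  "computable X \<longleftrightarrow> (\<exists>R K send pub h. \<forall>n N. graph_on n N \<longrightarrow>
     bounded_rounds send pub R K n N \<and> X n N = h n (transcript send pub n N R))"

lemma length_transcript [simp]: "length (transcript send pub n N t) = t"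
  by (induction t) auto

text \<open>The least significant digit comes first and zero is coded by the empty string, so the
  number 0 costs no message and silence is read as 0.\<close>

fun bits :: "nat \<Rightarrow> bool list" where
  "bits k = (if k = 0 then [] else odd k # bits (k div 2))"

declare bits.simps [simp del]

primrec bits_value :: "bool list \<Rightarrow> nat" where
  "bits_value [] = 0"
| "bits_value (b # bs) = of_bool b + 2 * bits_value bs"

lemma bits_value_bits [simp]: "bits_value (bits k) = k"
proof (induction k rule: bits.induct)
  case (1 k)
  show ?case
  proof (cases "k = 0")
    case False
    have "of_bool (odd k) + 2 * (k div 2) = k"
      by (simp add: of_bool_odd_eq_mod_2)
    then show ?thesis
      using False 1 by (subst bits.simps) simp
  qed (simp add: bits.simps)
qed

lemma length_bits: "k < 2 ^ j \<Longrightarrow> length (bits k) \<le> j"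
proof (induction k arbitrary: j rule: bits.induct)
  case (1 k)
  show ?case
  proof (cases "k = 0")
    case False
    then obtain i where j: "j = Suc i"
      using 1 by (cases j) auto
    show ?thesis
      using False 1 by (subst bits.simps) (auto simp: j)
  qed (simp add: bits.simps)
qed

text \<open>With \<open>j\<close> the rounded-up logarithm of \<open>n + 1\<close>,
  \<open>j * K\<close> digits suffice. From \<open>n = 2\<close> on the logarithm of
  \<open>n\<close> is at least 1 and absorbs both the rounding and the shift by one, whence the
  factor 3.\<close>

lemma length_bits_le_log:
  assumes "2 \<le> n" "k < (n + 1) ^ K"
  shows "real (length (bits k)) \<le> 3 * real K * log 2 (real n)"
proof -
  define j where "j = nat \<lceil>log 2 (real n + 1)\<rceil>"
  have L1: "1 \<le> log 2 (real n)"
    using assms by (simp add: le_log_iff)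
  have "log 2 (real n + 1) \<le> log 2 (2 * real n)"
    using assms by (subst log_le_cancel_iff) auto
  also have "\<dots> = 1 + log 2 (real n)"
    using assms by (simp add: log_mult)
  finally have jle: "real j \<le> 3 * log 2 (real n)"
    unfolding j_def using L1 by linarith
  have "real n + 1 = 2 powr (log 2 (real n + 1))"
    by simp
  also have "\<dots> \<le> 2 powr real j"
    unfolding j_def by (intro powr_mono) (auto intro: real_nat_ceiling_ge)
  also have "\<dots> = 2 ^ j"
    by (simp add: powr_realpow)
  finally have "real (n + 1) \<le> real (2 ^ j)"
    by simp
  then have "n + 1 \<le> 2 ^ j"
    by (simp only: of_nat_le_iff)
  then have "(n + 1) ^ K \<le> 2 ^ (j * K)"
    by (metis power_mono power_mult zero_le)
  then have "length (bits k) \<le> j * K"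
    using assms(2) by (intro length_bits) linarith
  then have "real (length (bits k)) \<le> real j * real K"
    by (metis of_nat_le_iff of_nat_mult)
  also have "\<dots> \<le> 3 * log 2 (real n) * real K"
    by (intro mult_right_mono jle) simp
  finally show ?thesis
    by (simp add: mult_ac)
qed

section \<open>Compilation to a Congested Clique algorithm\<close>

text \<open>
  The number of machines, the identifier, the neighbours, the tables of announcements so far, and,
  between the two halves of a round, the private numbers received.
\<close>

type_synonym machine = "nat \<times> nat \<times> nat list \<times> nat list list \<times> nat list option"

definition table :: "nat list \<Rightarrow> nat \<Rightarrow> nat" where
  "table l = (\<lambda>u. if u < length l then l ! u else 0)"

lemma table_map: "(\<And>u. n \<le> u \<Longrightarrow> c u = 0) \<Longrightarrow> table (map c [0..<n]) = c"
  by (auto simp: table_def fun_eq_iff)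

text \<open>Each round with announcements takes two rounds of the clique: private numbers are sent
  while the last component is \<open>None\<close>, and the announcement, the same for all
  \<open>u\<close>, while it is \<open>Some l\<close>.\<close>

fun message :: "send_rule \<Rightarrow> publish_rule \<Rightarrow> machine \<Rightarrow> nat \<Rightarrow> nat" where
  "message send pub (n, v, a, cs, None) u = send n (map table cs) (set a) v u"
| "message send pub (n, v, a, cs, Some l) u = pub n (map table cs) (set a) v (table l)"

fun machine_step :: "machine \<Rightarrow> nat list \<Rightarrow> machine" where
  "machine_step (n, v, a, cs, None) ms = (n, v, a, cs, Some ms)"
| "machine_step (n, v, a, cs, Some l) ms = (n, v, a, cs @ [ms], None)"

text \<open>The inbox holds nothing from \<open>v\<close> itself, so the entry at \<open>v\<close>
  is computed locally.\<close>

fun incoming :: "send_rule \<Rightarrow> publish_rule \<Rightarrow> machine \<Rightarrow> (nat \<Rightarrow> bool list) \<Rightarrow> nat list" where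
  "incoming send pub (n, v, x) m =
     map (\<lambda>u. if u = v then message send pub (n, v, x) v else bits_value (m u)) [0..<n]"

fun machine_output ::
    "nat \<Rightarrow> (nat \<Rightarrow> (nat \<Rightarrow> nat) list \<Rightarrow> nat set) \<Rightarrow> machine \<Rightarrow> bool option" where
  "machine_output R h (n, v, a, cs, r) =
     (if length cs = R then Some (v \<in> h n (map table cs)) else None)"

text \<open>All distributions are point masses. Machine states form a countable type and are coded
  as natural numbers.\<close>

definition compile ::
    "send_rule \<Rightarrow> publish_rule \<Rightarrow> nat \<Rightarrow> (nat \<Rightarrow> (nat \<Rightarrow> nat) list \<Rightarrow> nat set) \<Rightarrow> nat cc_algorithm"
  where
  "compile send pub R h =
    \<lparr>cc_init = (\<lambda>n v A. return_pmf (to_nat ((n, v, sorted_list_of_set A, [], None) :: machine))),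
     cc_send = (\<lambda>s u. bits (message send pub (from_nat s) u)),
     cc_recv = (\<lambda>s m. return_pmf (to_nat
       (machine_step (from_nat s) (incoming send pub (from_nat s) m)))),
     cc_output = (\<lambda>s. machine_output R h (from_nat s))\<rparr>"

definition machine_at ::
    "send_rule \<Rightarrow> publish_rule \<Rightarrow> nat \<Rightarrow> (nat \<Rightarrow> nat set) \<Rightarrow> nat \<Rightarrow> nat \<Rightarrow> machine" where
  "machine_at send pub n N t v =
     (let C = transcript send pub n N (t div 2) in
      (n, v, sorted_list_of_set (N v), map (\<lambda>c. map c [0..<n]) C,
       if even t then None else Some (map (received send n N C v) [0..<n])))"

lemma tables_transcript:
  "map table (map (\<lambda>c. map c [0..<n]) (transcript send pub n N t)) = transcript send pub n N t"
  by (induction t) (simp_all, simp add: table_map published_def)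

lemma graph_on_finite: "graph_on n N \<Longrightarrow> finite (N v)"
  by (rule finite_subset[of _ "{..<n}"]) (auto simp: graph_on_def)

lemma message_machine_at:
  assumes "graph_on n N" "v < n" "u < n"
  shows "message send pub (machine_at send pub n N t v) u =
    (let C = transcript send pub n N (t div 2) in
     if even t then received send n N C u v else published send pub n N C v)"
  using assms graph_on_finite[OF assms(1), of v]
  by (simp add: machine_at_def Let_def tables_transcript del: map_map)
    (simp add: received_def published_def table_map)

lemma machine_step_machine_at:
  assumes "graph_on n N" "v < n"
    and m: "\<And>u. u < n \<Longrightarrow> u \<noteq> v \<Longrightarrow> m u = bits (message send pub (machine_at send pub n N t u) v)"
  shows "machine_step (machine_at send pub n N t v) (incoming send pub (machine_at send pub n N t v) m)
       = machine_at send pub n N (Suc t) v"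
proof -
  let ?s = "machine_at send pub n N t v"
  let ?C = "transcript send pub n N (t div 2)"
  obtain x where s: "?s = (n, v, x)"
    by (metis machine_at_def)
  have in_eq: "incoming send pub ?s m = map (\<lambda>u. message send pub (machine_at send pub n N t u) v) [0..<n]"
    unfolding s by (auto simp: m s)
  show ?thesis
  proof (cases "even t")
    case True
    have "map (\<lambda>u. message send pub (machine_at send pub n N t u) v) [0..<n] =
        map (received send n N ?C v) [0..<n]"
      using assms True by (auto simp: message_machine_at Let_def)
    then show ?thesis
      unfolding in_eq using True by (simp add: machine_at_def Let_def)
  next
    case False
    have "map (\<lambda>u. message send pub (machine_at send pub n N t u) v) [0..<n] =
        map (published send pub n N ?C) [0..<n]"
      using assms False by (auto simp: message_machine_at Let_def)
    then show ?thesis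
      unfolding in_eq using False by (simp add: machine_at_def Let_def)
  qed
qed

context
  fixes send :: send_rule and pub :: publish_rule and R :: nat
    and h :: "nat \<Rightarrow> (nat \<Rightarrow> nat) list \<Rightarrow> nat set" and n :: nat
    and N :: "nat \<Rightarrow> nat set" and G :: "nat pair_pre_digraph"
  assumes input: "cc_input n G"
  assumes N: "N = (\<lambda>v. {u. (v, u) \<in> parcs G})"
begin

abbreviation (input) "alg \<equiv> compile send pub R h"

lemma graph_on_input: "graph_on n N"
proof -
  interpret pair_graph G
    using input by (simp add: cc_input_def)
  have "pverts G = {..<n}"
    using input by (simp add: cc_input_def)
  then have "u < n \<and> (u, v) \<in> parcs G \<and> u \<noteq> v" if "(v, u) \<in> parcs G" for u v
    using that arcs_symmetric no_loops wellformed by fastforce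
  then show ?thesis
    unfolding graph_on_def N by simp
qed

text \<open>The minimum accounts for freezing: all machines halt together after \<open>2 * R\<close>
  rounds of the clique, when they hold \<open>R\<close> tables. Outside \<open>{..<n}\<close> the
  value is the default of the product distribution.\<close>

definition config where
  "config t = (\<lambda>v. if v < n then to_nat (machine_at send pub n N (min t (2 * R)) v) else undefined)"

lemma halted_config:
  "v < n \<Longrightarrow> cc_halted alg (config t v) \<longleftrightarrow> 2 * R \<le> t"
  by (auto simp: config_def cc_halted_def compile_def machine_at_def Let_def)

lemma inbox_config:
  assumes "v < n"
  shows "cc_inbox alg n (config t) v u =
    (if u < n \<and> u \<noteq> v \<and> t < 2 * R then bits (message send pub (machine_at send pub n N t u) v) else [])"
  by (auto simp: cc_inbox_def halted_config) (simp add: config_def compile_def)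

lemma run_compile: "cc_run alg n G t = return_pmf (config t)"
proof (induction t)
  case 0
  show ?case
    unfolding config_def by (simp add: compile_def N machine_at_def Let_def fun_eq_iff)
next
  case (Suc t)
  have "cc_round alg n (config t) = return_pmf (config (Suc t))"
  proof -
    have "(if cc_halted alg (config t v) then return_pmf (config t v)
          else cc_recv alg (config t v) (cc_inbox alg n (config t) v)) =
         return_pmf (config (Suc t) v)" if "v < n" for v
    proof (cases "2 * R \<le> t")
      case True
      then show ?thesis
        using that by (simp add: halted_config) (simp add: config_def)
    next
      case False
      have "machine_step (machine_at send pub n N t v)
          (incoming send pub (machine_at send pub n N t v) (cc_inbox alg n (config t) v)) =
        machine_at send pub n N (Suc t) v"
        using False that
        by (intro machine_step_machine_at graph_on_input) (auto simp: inbox_config)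
      then show ?thesis
        using False that by (simp add: halted_config) (simp add: compile_def config_def)
    qed
    then have "cc_round alg n (config t) =
        Pi_pmf {..<n} undefined (\<lambda>v. return_pmf (config (Suc t) v))"
      unfolding cc_round_def by (intro Pi_pmf_cong) auto
    also have "\<dots> = return_pmf (config (Suc t))"
      by (subst Pi_pmf_return_pmf) (auto simp: config_def fun_eq_iff)
    finally show ?thesis .
  qed
  then show ?case
    by (simp add: Suc bind_return_pmf)
qed

lemma all_halted_config: "2 * R \<le> t \<Longrightarrow> cc_all_halted alg n (config t)"
  by (auto simp: cc_all_halted_def halted_config)

lemma result_config:
  assumes "cc_all_halted alg n (config t)"
  shows "cc_result alg n (config t) = {v. v < n \<and> v \<in> h n (transcript send pub n N R)}"
proof -
  have "cc_output alg (config t v) = Some (v \<in> h n (transcript send pub n N R))" if "v < n" for v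
  proof -
    have "2 * R \<le> t"
      using assms that by (auto simp: cc_all_halted_def halted_config)
    then show ?thesis
      using that
      by (simp add: config_def compile_def machine_at_def Let_def tables_transcript del: map_map)
  qed
  then show ?thesis
    by (auto simp: cc_result_def)
qed

lemma prob_halted_compile: "2 * R \<le> t \<Longrightarrow> cc_prob_halted alg n G t = 1"
  by (simp add: cc_prob_halted_def run_compile all_halted_config)

lemma length_inbox_compile:
  assumes bound: "bounded_rounds send pub R K n N"
    and "\<sigma> \<in> set_pmf (cc_run alg n G t)" "u < n" "v < n"
  shows "real (length (cc_inbox alg n \<sigma> v u)) \<le> 3 * real K * log 2 (real n)"
proof (cases "u \<noteq> v \<and> t < 2 * R")
  case True
  have \<sigma>: "\<sigma> = config t"
    using assms(2) by (simp add: run_compile)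
  have "t div 2 < R"
    using True by auto
  then have "message send pub (machine_at send pub n N t u) v < (n + 1) ^ K"
    using bound assms(3,4) graph_on_input
    by (auto simp: message_machine_at Let_def bounded_rounds_def)
  \<comment> \<open>A message needs two distinct machines. For \<open>n = 1\<close> the logarithmic
    bound is zero, but nothing is sent.\<close>
  moreover have "2 \<le> n"
    using True assms by auto
  ultimately show ?thesis
    using True assms(3,4) by (simp add: \<sigma> inbox_config length_bits_le_log)
next
  case False
  then have "cc_inbox alg n \<sigma> v u = []"
    using assms(2-4) by (auto simp: run_compile inbox_config)
  moreover have "0 \<le> log 2 (real n)"
    using assms(3) by simp
  ultimately show ?thesis
    by simp
qed

end

text \<open>All machines have halted after round \<open>2 * R\<close> with probability 1, so one
  round bound serves every exponent \<open>c\<close>. The intersection with \<open>{..<n}\<close>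
  reflects that only machines below \<open>n\<close> give an output.\<close>

lemma compile_correct:
  assumes "computable S"
    and P: "\<And>n G. cc_input n G \<Longrightarrow>
      P G (S n (\<lambda>v. {u. (v, u) \<in> parcs G}) \<inter> {..<n})"
  shows "\<exists>A :: nat cc_algorithm.
    cc_log_bandwidth A \<and> cc_finds A P \<and> cc_constant_rounds_whp A"
proof -
  obtain R K send pub h where *: "\<And>n N. graph_on n N \<Longrightarrow>
      bounded_rounds send pub R K n N \<and> S n N = h n (transcript send pub n N R)"
    using assms(1) unfolding computable_def by metis
  let ?A = "compile send pub R h"
  have "cc_log_bandwidth ?A"
    unfolding cc_log_bandwidth_def
  proof (intro exI[of _ "3 * real K"] allI impI ballI)
    fix n G t \<sigma> u v
    assume input: "cc_input n G" and "\<sigma> \<in> set_pmf (cc_run ?A n G t)" "u < n" "v < n"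
    then show "real (length (cc_inbox ?A n \<sigma> v u)) \<le> 3 * real K * log 2 (real n)"
      using *[OF graph_on_input[OF input refl]]
      by (intro length_inbox_compile[OF input refl]) auto
  qed
  moreover have "cc_finds ?A P"
    unfolding cc_finds_def
  proof (intro allI impI conjI ballI)
    fix n G
    assume input: "cc_input n G"
    have "\<forall>\<^sub>F t in sequentially. cc_prob_halted ?A n G t = 1"
      using prob_halted_compile[OF input refl, of R]
      by (intro eventually_sequentiallyI[of "2 * R"])
    then show "cc_prob_halted ?A n G \<longlonglongrightarrow> 1"
      by (rule tendsto_eventually)
    fix t \<sigma>
    assume \<sigma>: "\<sigma> \<in> set_pmf (cc_run ?A n G t)" and halted: "cc_all_halted ?A n \<sigma>"
    let ?N = "\<lambda>v. {u. (v, u) \<in> parcs G}"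
    have "S n ?N = h n (transcript send pub n ?N R)"
      using * graph_on_input[OF input refl] by blast
    then have "cc_result ?A n \<sigma> = S n ?N \<inter> {..<n}"
      using \<sigma> halted result_config[OF input refl] by (auto simp: run_compile[OF input refl])
    then show "P G (cc_result ?A n \<sigma>)"
      using P[OF input] by simp
  qed
  moreover have "cc_constant_rounds_whp ?A"
    unfolding cc_constant_rounds_whp_def
    using prob_halted_compile[OF _ refl] by (auto intro!: exI[of _ "2 * R"])
  ultimately show ?thesis
    by blast
qed

section \<open>Closure properties of computable values\<close>

lemma computable_cong:
  assumes "computable X" "\<And>n N. graph_on n N \<Longrightarrow> Y n N = X n N"
  shows "computable Y"
  using assms unfolding computable_def by simp

lemma computable_const: "computable (\<lambda>n N. c n)"
  unfolding computable_def
  by (intro exI[of _ "0 :: nat"] exI[of _ "\<lambda>_ _ _ _ _. 0"] exI[of _ "\<lambda>_ _ _ _ _. 0"]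
      exI[of _ "\<lambda>n _. c n"])
    (simp add: bounded_rounds_def)

lemma computable_map:
  assumes "computable X"
  shows "computable (\<lambda>n N. f n (X n N))"
proof -
  obtain R K send pub h where *: "\<And>n N. graph_on n N \<Longrightarrow>
      bounded_rounds send pub R K n N \<and> X n N = h n (transcript send pub n N R)"
    using assms unfolding computable_def by metis
  show ?thesis
    unfolding computable_def
    by (rule exI[of _ R], rule exI[of _ K], rule exI[of _ send], rule exI[of _ pub],
        rule exI[of _ "\<lambda>n C. f n (h n C)"]) (simp add: *)
qed

text \<open>One round is appended to a protocol for \<open>X\<close>. By then \<open>X n N\<close>
  is common knowledge, so the private numbers and the announcement may depend on it; the length of
  the transcript tells the machines when the new round has come.\<close>

lemma computable_exchange_nat:
  assumes "computable X"
    and s: "\<And>n N u v. graph_on n N \<Longrightarrow> u < n \<Longrightarrow> v < n \<Longrightarrow> s n (X n N) (N v) v u < (n + 1) ^ K"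
    and p: "\<And>n N u. graph_on n N \<Longrightarrow> u < n \<Longrightarrow>
      p n (X n N) (N u) u (\<lambda>v. if v < n then s n (X n N) (N v) v u else 0) < (n + 1) ^ K"
  shows "computable (\<lambda>n N. (X n N, \<lambda>u. if u < n then
    p n (X n N) (N u) u (\<lambda>v. if v < n then s n (X n N) (N v) v u else 0) else 0))"
proof -
  obtain R K' send pub h where *: "\<And>n N. graph_on n N \<Longrightarrow>
      bounded_rounds send pub R K' n N \<and> X n N = h n (transcript send pub n N R)"
    using assms(1) unfolding computable_def by metis
  define send' :: send_rule where
    "send' = (\<lambda>n C. if length C < R then send n C else s n (h n C))"
  define pub' :: publish_rule where
    "pub' = (\<lambda>n C. if length C < R then pub n C else p n (h n C))"
  have old: "received send' n N (transcript send pub n N t) = received send n N (transcript send pub n N t)"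
    "published send' pub' n N (transcript send pub n N t) = published send pub n N (transcript send pub n N t)"
    if "t < R" for t n N
    using that by (auto simp: published_def received_def send'_def pub'_def fun_eq_iff)
  have tr: "transcript send' pub' n N t = transcript send pub n N t" if "t \<le> R" for t n N
    using that by (induction t) (auto simp: old)
  have new: "received send' n N (transcript send pub n N R) u v =
        (if u < n \<and> v < n then s n (X n N) (N v) v u else 0)"
      "published send' pub' n N (transcript send pub n N R) u =
        (if u < n then p n (X n N) (N u) u (\<lambda>v. if v < n then s n (X n N) (N v) v u else 0) else 0)"
    if "graph_on n N" for n N u v
    using *[OF that] by (simp_all add: published_def received_def send'_def pub'_def cong: if_cong)
  have "bounded_rounds send' pub' (Suc R) (max K' K) n N" if N: "graph_on n N" for n N
    unfolding bounded_rounds_def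
  proof (intro allI impI)
    fix t u v
    assume "t < Suc R"
    have le: "(n + 1) ^ K' \<le> (n + 1) ^ max K' K" "(n + 1) ^ K \<le> (n + 1) ^ max K' K"
      by (intro power_increasing; simp)+
    show "received send' n N (transcript send' pub' n N t) u v < (n + 1) ^ max K' K \<and>
      published send' pub' n N (transcript send' pub' n N t) u < (n + 1) ^ max K' K"
    proof (cases "t < R")
      case True
      then have "received send n N (transcript send pub n N t) u v < (n + 1) ^ K'"
        "published send pub n N (transcript send pub n N t) u < (n + 1) ^ K'"
        using *[OF N] by (auto simp: bounded_rounds_def)
      then show ?thesis
        using True le(1) by (simp add: tr old)
    next
      case False
      then have "t = R"
        using \<open>t < Suc R\<close> by simp
      then show ?thesis
        using s[OF N, of u v, THEN less_le_trans, OF _ _ le(2)]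
          p[OF N, of u, THEN less_le_trans, OF _ le(2)] by (auto simp: tr new N)
    qed
  qed
  then show ?thesis
    unfolding computable_def
    by (intro exI[of _ "Suc R"] exI[of _ "max K' K"] exI[of _ send'] exI[of _ pub']
        exI[of _ "\<lambda>n C. (h n (take R C), C ! R)"])
      (auto simp: tr * fun_eq_iff new nth_append)
qed

text \<open>An announcement from a finite set \<open>B n\<close> of polynomial size is replaced by
  its index in an enumeration of \<open>B n\<close> that all machines share.\<close>

lemma computable_exchange:
  fixes p :: "nat \<Rightarrow> 'a \<Rightarrow> nat set \<Rightarrow> nat \<Rightarrow> (nat \<Rightarrow> nat) \<Rightarrow> 'b"
  assumes X: "computable X"
    and B: "\<And>n. finite (B n)" "\<And>n. 0 < n \<Longrightarrow> card (B n) \<le> (n + 1) ^ K"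
    and s: "\<And>n N u v. graph_on n N \<Longrightarrow> u < n \<Longrightarrow> v < n \<Longrightarrow> s n (X n N) (N v) v u < (n + 1) ^ K"
    and p: "\<And>n N u. graph_on n N \<Longrightarrow> u < n \<Longrightarrow>
      p n (X n N) (N u) u (\<lambda>v. if v < n then s n (X n N) (N v) v u else 0) \<in> B n"
  shows "computable (\<lambda>n N. (X n N, \<lambda>u. if u < n then
    p n (X n N) (N u) u (\<lambda>v. if v < n then s n (X n N) (N v) v u else 0) else d))"
proof -
  let ?p = "\<lambda>n x A u m. to_nat_on (B n) (p n x A u m)"
  have "computable (\<lambda>n N. (X n N, \<lambda>u. if u < n then
    ?p n (X n N) (N u) u (\<lambda>v. if v < n then s n (X n N) (N v) v u else 0) else 0))"
  proof (intro computable_exchange_nat[where K = K] X s)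
    fix n N u
    assume *: "graph_on n N" "u < n"
    let ?m = "p n (X n N) (N u) u (\<lambda>v. if v < n then s n (X n N) (N v) v u else 0)"
    have "to_nat_on (B n) ?m < card (B n)"
      using to_nat_on_finite[OF B(1)] p[OF *] by (auto simp: bij_betw_def)
    also have "\<dots> \<le> (n + 1) ^ K"
      using B(2) * by simp
    finally show "to_nat_on (B n) ?m < (n + 1) ^ K" .
  qed
  then have "computable (\<lambda>n N. (\<lambda>n (x, c). (x, \<lambda>u. if u < n then from_nat_into (B n) (c u) else d)) n (X n N, \<lambda>u. if u < n then
    ?p n (X n N) (N u) u (\<lambda>v. if v < n then s n (X n N) (N v) v u else 0) else 0))"
    by (rule computable_map)
  then show ?thesis
    by (rule computable_cong)
      (auto simp: fun_eq_iff countable_finite[OF B(1)] from_nat_into_to_nat_on[OF _ p])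
qed

text \<open>A machine adds up what it receives: \<open>n\<close> numbers below
  \<open>(n + 1) ^ K\<close> have a sum below \<open>(n + 1) ^ Suc K\<close>, which fits into one
  announcement.\<close>

lemma computable_exchange_numbers:
  assumes "computable X"
    and "\<And>n N u v. graph_on n N \<Longrightarrow> u < n \<Longrightarrow> v < n \<Longrightarrow> s n (X n N) (N v) v u < (n + 1) ^ K"
  shows "computable (\<lambda>n N. (X n N, \<lambda>u. if u < n then \<Sum>v<n. s n (X n N) (N v) v u else 0))"
proof -
  let ?p = "\<lambda>n x A u m. \<Sum>v<n. m v :: nat"
  have "computable (\<lambda>n N. (X n N, \<lambda>u. if u < n then
    ?p n (X n N) (N u) u (\<lambda>v. if v < n then s n (X n N) (N v) v u else 0) else 0))"
  proof (rule computable_exchange_nat[where K = "Suc K"])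
    fix n N u
    assume *: "graph_on n N" "u < n"
    have "(\<Sum>v<n. if v < n then s n (X n N) (N v) v u else 0) \<le> (\<Sum>v<n. (n + 1) ^ K)"
      by (intro sum_mono) (use * assms(2) in \<open>auto intro: less_imp_le\<close>)
    also have "\<dots> < (n + 1) ^ Suc K"
      by simp
    finally show "(\<Sum>v<n. if v < n then s n (X n N) (N v) v u else 0) < (n + 1) ^ Suc K" .
  next
    fix n N u v
    assume "graph_on n N" "u < n" "v < n"
    then show "s n (X n N) (N v) v u < (n + 1) ^ Suc K"
      using assms(2)[of n N u v] by (meson less_le_trans le_add2 lessI less_imp_le power_increasing)
  qed (use assms in auto)
  then show ?thesis
    by (rule computable_cong) (auto intro!: sum.cong)
qed

lemma computable_publish:
  fixes p :: "nat \<Rightarrow> 'a \<Rightarrow> nat set \<Rightarrow> nat \<Rightarrow> 'b"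
  assumes "computable X"
    and "\<And>n. finite (B n)" "\<And>n. 0 < n \<Longrightarrow> card (B n) \<le> (n + 1) ^ K"
    and "\<And>n N u. graph_on n N \<Longrightarrow> u < n \<Longrightarrow> p n (X n N) (N u) u \<in> B n"
  shows "computable (\<lambda>n N. (X n N, \<lambda>u. if u < n then p n (X n N) (N u) u else d))"
  by (rule computable_exchange[where s = "\<lambda>_ _ _ _ _. 0" and p = "\<lambda>n x A u _. p n x A u"
        and B = B and K = K]) (use assms in auto)

lemma computable_flags:
  assumes "computable X"
  shows "computable (\<lambda>n N. (X n N, {v. v < n \<and> P n (X n N) (N v) v}))"
proof -
  have "computable (\<lambda>n N. (X n N, \<lambda>u. if u < n then P n (X n N) (N u) u else False))"
    by (rule computable_publish[where B = "\<lambda>_. UNIV" and K = 1]) (use assms in auto)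
  then have "computable (\<lambda>n N. (\<lambda>n (x, c). (x, {v. c v})) n
      (X n N, \<lambda>u. if u < n then P n (X n N) (N u) u else False))"
    by (rule computable_map)
  then show ?thesis
    by (rule computable_cong) auto
qed

section \<open>Selecting a seed and gathering edges\<close>

lemma arg_min_nat_sum_le:
  fixes c :: "nat \<Rightarrow> nat"
  assumes "0 < n"
  shows "\<exists>u<n. n * c u \<le> sum c {..<n}"
proof -
  obtain u where u: "u < n" "\<And>w. w < n \<Longrightarrow> c u \<le> c w"
    using ex_has_least_nat[of "\<lambda>u. u < n" 0 c] assms by auto
  have "n * c u = (\<Sum>w<n. c u)"
    by simp
  also have "\<dots> \<le> sum c {..<n}"
    by (intro sum_mono u) auto
  finally show ?thesis
    using u(1) by blast
qed

lemma sum_lessThan_mult: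
  fixes F :: "nat \<Rightarrow> 'a :: comm_monoid_add"
  shows "(\<Sum>u<n. \<Sum>j<m. F (c + u * m + j)) = (\<Sum>j<n * m. F (c + j))"
proof -
  have "(\<Sum>j<m. F (c + u * m + j)) = (\<Sum>j\<in>{u * m..<u * m + m}. F (c + j))" for u
    by (rule sum.reindex_bij_witness[of _ "\<lambda>j. j - u * m" "\<lambda>j. u * m + j"]) (auto simp: add_ac)
  then show ?thesis
    by (simp add: sum.nat_group)
qed

text \<open>
  The method of conditional expectations with one digit in base \<open>n\<close> per step: machine \<open>u\<close> collects
  the total cost of all continuations with next digit \<open>u\<close>.
\<close>

lemma computable_select:
  fixes f :: "nat \<Rightarrow> 'a \<Rightarrow> nat set \<Rightarrow> nat \<Rightarrow> nat \<Rightarrow> nat"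
  assumes X: "computable X"
    and bound: "\<And>n N v j. graph_on n N \<Longrightarrow> v < n \<Longrightarrow> j < n ^ a \<Longrightarrow> f n (X n N) (N v) v j \<le> (n + 1) ^ b"
  shows "\<exists>J. computable (\<lambda>n N. (X n N, J n N)) \<and>
    (\<forall>n N. graph_on n N \<and> 0 < n \<longrightarrow> J n N < n ^ a \<and>
      n ^ a * (\<Sum>v<n. f n (X n N) (N v) v (J n N)) \<le> (\<Sum>j<n ^ a. \<Sum>v<n. f n (X n N) (N v) v j))"
proof -
  define F where "F = (\<lambda>n N j. \<Sum>v<n. f n (X n N) (N v) v j)"
  \<comment> \<open>After \<open>t\<close> steps \<open>J\<close> is a prefix of \<open>t\<close>
    digits. Its continuations form a block of \<open>n ^ (a - t)\<close> consecutive indices, and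
    the invariant says that the average cost over this block is at most the average over all
    indices.\<close>
  have "\<exists>J. computable (\<lambda>n N. (X n N, J n N)) \<and>
    (\<forall>n N. graph_on n N \<and> 0 < n \<longrightarrow> J n N < n ^ t \<and>
      n ^ t * (\<Sum>j<n ^ (a - t). F n N (J n N * n ^ (a - t) + j)) \<le> (\<Sum>j<n ^ a. F n N j))"
    if "t \<le> a" for t
    using that
  proof (induction t)
    case 0
    have "computable (\<lambda>n N. (X n N, 0 :: nat))"
      using computable_map[OF X, of "\<lambda>_ x. (x, 0)"] .
    then show ?case
      by (intro exI[of _ "\<lambda>_ _. 0"]) auto
  next
    case (Suc t)
    define m where "m = (\<lambda>n. n ^ (a - Suc t) :: nat)"
    have n_m: "n ^ (a - t) = n * m n" for n
      using Suc.prems by (simp add: m_def flip: power_Suc Suc_diff_le)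
    from Suc obtain J where J: "computable (\<lambda>n N. (X n N, J n N))"
      and J': "\<And>n N. graph_on n N \<Longrightarrow> 0 < n \<Longrightarrow> J n N < n ^ t \<and>
        n ^ t * (\<Sum>j<n * m n. F n N (J n N * (n * m n) + j)) \<le> (\<Sum>j<n ^ a. F n N j)"
      by (auto simp: n_m)
    define s where "s = (\<lambda>n (x, i) A v u. \<Sum>j<m n. f n x A v (i * (n * m n) + u * m n + j))"
    have index: "J n N * (n * m n) + u * m n + j < n ^ a"
      if "graph_on n N" "u < n" "j < m n" for n N u j
    proof -
      have "J n N * (n * m n) + u * m n + j < J n N * (n * m n) + u * m n + m n"
        using that by simp
      also have "\<dots> = J n N * (n * m n) + (u + 1) * m n"
        by (simp add: algebra_simps)
      also have "\<dots> \<le> J n N * (n * m n) + n * m n"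
        using that by (intro add_mono mult_right_mono) auto
      also have "\<dots> = (J n N + 1) * (n * m n)"
        by (simp add: algebra_simps)
      also have "\<dots> \<le> n ^ t * (n * m n)"
        using J'[OF that(1)] that by (intro mult_right_mono) auto
      also have "\<dots> = n ^ a"
        using Suc.prems by (simp flip: n_m power_add)
      finally show ?thesis .
    qed
    define c where "c = (\<lambda>n N u. if u < n then \<Sum>v<n. s n (X n N, J n N) (N v) v u else 0)"
    have "computable (\<lambda>n N. ((X n N, J n N), c n N))"
      unfolding c_def
    proof (rule computable_exchange_numbers[OF J, where K = "a + b + 1"])
      fix n N u v
      assume *: "graph_on n N" "u < n" "v < n"
      have "s n (X n N, J n N) (N v) v u \<le> (\<Sum>j<m n. (n + 1) ^ b)"
        unfolding s_def prod.case using * by (intro sum_mono bound index) auto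
      also have "\<dots> = m n * (n + 1) ^ b"
        by simp
      also have "\<dots> \<le> (n + 1) ^ a * (n + 1) ^ b"
      proof (rule mult_right_mono)
        have "m n \<le> (n + 1) ^ (a - Suc t)"
          unfolding m_def by (intro power_mono) auto
        also have "\<dots> \<le> (n + 1) ^ a"
          by (intro power_increasing) auto
        finally show "m n \<le> (n + 1) ^ a" .
      qed simp
      also have "\<dots> < (n + 1) ^ (a + b + 1)"
        using * by (simp add: power_add)
      finally show "s n (X n N, J n N) (N v) v u < (n + 1) ^ (a + b + 1)" .
    qed
    \<comment> \<open>The sums \<open>c\<close> are public, so all machines apply the same rule and
      append the same digit.\<close>
    define best where "best = (\<lambda>n c. SOME u. u < n \<and> n * c u \<le> sum c {..<n :: nat})"
    have best: "best n c < n \<and> n * c (best n c) \<le> sum c {..<n}" if "0 < n" for n and c :: "nat \<Rightarrow> nat"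
      unfolding best_def using arg_min_nat_sum_le[OF that] by (rule someI_ex)
    have "computable (\<lambda>n N. (\<lambda>n ((x, i), c). (x, i * n + best n c)) n ((X n N, J n N), c n N))"
      by (rule computable_map) fact
    then have "computable (\<lambda>n N. (X n N, J n N * n + best n (c n N)))"
      by simp
    moreover have "J n N * n + best n (c n N) < n ^ Suc t \<and>
       n ^ Suc t * (\<Sum>j<m n. F n N ((J n N * n + best n (c n N)) * m n + j)) \<le> (\<Sum>j<n ^ a. F n N j)"
      if *: "graph_on n N" "0 < n" for n N
    proof
      let ?u = "best n (c n N)"
      have "J n N * n + ?u < (J n N + 1) * n"
        using best[OF *(2)] by simp
      also have "\<dots> \<le> n ^ t * n"
        using J'[OF *] by (intro mult_right_mono) auto
      finally show "J n N * n + ?u < n ^ Suc t"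
        by (simp add: mult.commute)
      have c_eq: "c n N u = (\<Sum>j<m n. F n N (J n N * (n * m n) + u * m n + j))" if "u < n" for u
        using that by (simp add: c_def s_def F_def sum.swap[of _ "{..<n}"])
      have "n * (\<Sum>j<m n. F n N ((J n N * n + ?u) * m n + j)) = n * c n N ?u"
        using best[OF *(2)] by (simp add: c_eq algebra_simps)
      also have "\<dots> \<le> (\<Sum>u<n. c n N u)"
        using best[OF *(2)] by blast
      also have "\<dots> = (\<Sum>j<n * m n. F n N (J n N * (n * m n) + j))"
        by (simp add: c_eq sum_lessThan_mult)
      finally have "n ^ t * (n * (\<Sum>j<m n. F n N ((J n N * n + ?u) * m n + j)))
        \<le> n ^ t * (\<Sum>j<n * m n. F n N (J n N * (n * m n) + j))"
        by (rule mult_left_mono) simp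
      also have "\<dots> \<le> (\<Sum>j<n ^ a. F n N j)"
        using J'[OF *] by blast
      finally show "n ^ Suc t * (\<Sum>j<m n. F n N ((J n N * n + ?u) * m n + j)) \<le> (\<Sum>j<n ^ a. F n N j)"
        by (simp only: power_Suc2 mult.assoc)
    qed
    ultimately show ?case
      unfolding m_def by (intro exI[of _ "\<lambda>n N. J n N * n + best n (c n N)"]) blast
  qed
  from this[of a] show ?thesis
    by (simp add: F_def)
qed

text \<open>In a numbering of all items, those of machine 0 first, then those of machine 1 and so
  on, the items of \<open>v\<close> take the \<open>e v\<close> numbers from
  \<open>offset e v\<close> on.\<close>

definition offset :: "(nat \<Rightarrow> nat) \<Rightarrow> nat \<Rightarrow> nat" where
  "offset e v = (\<Sum>w<v. e w)"

lemma offset_mono: "v < w \<Longrightarrow> offset e v + e v \<le> offset e w"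
proof -
  assume "v < w"
  then have "sum e {..<Suc v} \<le> sum e {..<w}"
    by (intro sum_mono2) auto
  then show ?thesis
    by (simp add: offset_def)
qed

lemma offset_inj:
  assumes "offset e v + k = offset e w + l" "k < e v" "l < e w"
  shows "v = w \<and> k = l"
  using assms offset_mono[of v w e] offset_mono[of w v e] by (cases v w rule: linorder_cases) auto

text \<open>At most \<open>n\<close> consecutive numbers have distinct residues. So a machine with
  at most \<open>n\<close> items sends no two of them to the same place.\<close>

lemma offset_mod_inj:
  fixes n :: nat
  assumes "(c + k) mod n = (c + l) mod n" "k < n" "l < n"
  shows "k = l"
  using assms
proof (induction k l rule: linorder_wlog)
  case (le k l)
  then have "n dvd l - k"
    using mod_eq_dvd_iff_nat[of "c + k" "c + l" n] by simp
  then have "l - k = 0"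
    using le nat_dvd_not_less[of "l - k" n] by linarith
  with le(1) show ?case
    by simp
qed simp

text \<open>Items with residue \<open>i\<close> have distinct quotients by \<open>n\<close>, and
  these are below \<open>K\<close> because all item numbers are below \<open>K * n\<close>. So
  machine \<open>i\<close> receives at most \<open>K\<close> items.\<close>

lemma card_route_le:
  assumes "(\<Sum>v<n. e v) \<le> K * n" "0 < n"
  shows "finite {(v, k). v < n \<and> k < e v \<and> (offset e v + k) mod n = i}" (is "finite ?A")
    and "card {(v, k). v < n \<and> k < e v \<and> (offset e v + k) mod n = i} \<le> K"
proof -
  have "?A \<subseteq> (SIGMA v : {..<n}. {..<e v})"
    by auto
  then show "finite ?A"
    by (rule finite_subset) auto
  let ?g = "\<lambda>(v, k). (offset e v + k) div n"
  have "inj_on ?g ?A"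
  proof (rule inj_onI, clarify)
    fix v k w l
    assume "(offset e v + k) div n = (offset e w + l) div n"
      "i = (offset e v + k) mod n" "(offset e w + l) mod n = (offset e v + k) mod n"
      and *: "k < e v" "l < e w"
    then have "offset e v + k = offset e w + l"
      by (metis div_mult_mod_eq)
    then show "v = w \<and> k = l"
      using * by (rule offset_inj)
  qed
  moreover have "?g ` ?A \<subseteq> {..<K}"
  proof clarify
    fix v k
    assume *: "v < n" "k < e v"
    have "offset e v + k < offset e v + e v"
      using * by simp
    also have "\<dots> \<le> K * n"
      using assms(1) offset_mono[OF *(1), of e] by (simp add: offset_def)
    finally show "(offset e v + k) div n < K"
      using assms(2) by (simp add: less_mult_imp_div_less)
  qed
  ultimately have "card ?A \<le> card {..<K}"
    by (rule card_inj_on_le) simp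
  then show "card ?A \<le> K"
    by simp
qed

text \<open>A set of at most \<open>K\<close> elements comes from a list of length at most
  \<open>K\<close>. For fixed \<open>K\<close> there are thus only polynomially many sets that a
  machine may have to publish.\<close>

lemma card_subsets_le:
  assumes "finite A"
  shows "card {P. P \<subseteq> A \<and> card P \<le> K} \<le> (card A + 1) ^ K"
proof -
  have "{P. P \<subseteq> A \<and> card P \<le> K} \<subseteq> set ` {xs. set xs \<subseteq> A \<and> length xs \<le> K}"
  proof clarify
    fix P
    assume P: "P \<subseteq> A" "card P \<le> K"
    then obtain xs where "set xs = P" "length xs = card P"
      by (metis assms finite_distinct_list finite_subset distinct_card)
    with P show "P \<in> set ` {xs. set xs \<subseteq> A \<and> length xs \<le> K}"
      by auto
  qed
  then have "card {P. P \<subseteq> A \<and> card P \<le> K} \<le> card {xs. set xs \<subseteq> A \<and> length xs \<le> K}"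
    by (rule surj_card_le[OF finite_lists_length_le[OF assms]])
  also have "\<dots> = (\<Sum>i\<le>K. card A ^ i)"
    by (rule card_lists_length_le[OF assms])
  also have "\<dots> \<le> (card A + 1) ^ K"
  proof (induction K)
    case (Suc K)
    have "card A ^ K \<le> (card A + 1) ^ K"
      by (rule power_mono) auto
    then have "card A ^ Suc K \<le> card A * (card A + 1) ^ K"
      unfolding power_Suc by (rule mult_left_mono) simp
    with Suc show ?case
      unfolding sum.atMost_Suc power_Suc[of "card A + 1"] distrib_right by linarith
  qed simp
  finally show ?thesis .
qed

text \<open>
  Items are spread over the machines in round-robin fashion, so that every machine holds a bounded
  number of them, which it then publishes.
\<close>

lemma computable_gather:
  fixes E :: "nat \<Rightarrow> 'a \<Rightarrow> nat set \<Rightarrow> nat \<Rightarrow> nat set"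
  assumes X: "computable X"
    and sub: "\<And>n N v. graph_on n N \<Longrightarrow> v < n \<Longrightarrow> E n (X n N) (N v) v \<subseteq> {..<n}"
    and total: "\<And>n N. graph_on n N \<Longrightarrow> (\<Sum>v<n. card (E n (X n N) (N v) v)) \<le> K * n"
  shows "computable (\<lambda>n N. (X n N, \<lambda>v. if v < n then E n (X n N) (N v) v else {}))"
proof -
  define e where "e = (\<lambda>n N v. if v < n then card (E n (X n N) (N v) v) else 0)"
  have Xe: "computable (\<lambda>n N. (X n N, e n N))"
    unfolding e_def
  proof (rule computable_publish[OF X, where B = "\<lambda>n. {..n}" and K = 1])
    fix n N u
    assume "graph_on n N" "u < n"
    then show "card (E n (X n N) (N u) u) \<in> {..n}"
      using sub card_mono[of "{..<n}"] by fastforce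
  qed auto
  define item where "item = (\<lambda>n (x, e :: nat \<Rightarrow> nat) A v k. sorted_list_of_set (E n x A v) ! k :: nat)"
  \<comment> \<open>The item with number \<open>j\<close> goes to machine \<open>j mod n\<close>.
    The successor tells the item 0 from no item.\<close>
  define s where "s = (\<lambda>n (x, e) A v i.
    if \<exists>k<e v. (offset e v + k) mod n = i
    then Suc (item n (x, e) A v (SOME k. k < e v \<and> (offset e v + k) mod n = i)) else 0)"
  define p where "p = (\<lambda>(n :: nat) (x :: 'a \<times> (nat \<Rightarrow> nat)) (A :: nat set) (i :: nat) m.
    {(v, w). v < n \<and> m v = Suc w})"
  define B where "B = (\<lambda>n. {P. P \<subseteq> {..<n} \<times> {..<n :: nat} \<and> card P \<le> K})"
  have set_item: "item n (X n N, e n N) (N v) v ` {..<e n N v} = E n (X n N) (N v) v"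
    if "graph_on n N" "v < n" for n N v
  proof -
    have "finite (E n (X n N) (N v) v)"
      using sub[OF that] by (rule finite_subset) simp
    then show ?thesis
      using that set_conv_nth[of "sorted_list_of_set (E n (X n N) (N v) v)"]
      by (auto simp: item_def e_def image_def)
  qed
  have item_less: "item n (X n N, e n N) (N v) v k < n" if "graph_on n N" "v < n" "k < e n N v" for n N v k
    using set_item[OF that(1,2)] sub[OF that(1,2)] that(3) by blast
  have s_cases: "s n (X n N, e n N) (N v) v i = 0 \<and> (\<forall>k<e n N v. (offset (e n N) v + k) mod n \<noteq> i) \<or>
      (\<exists>k<e n N v. (offset (e n N) v + k) mod n = i \<and>
        s n (X n N, e n N) (N v) v i = Suc (item n (X n N, e n N) (N v) v k))" for n N v i
    using someI_ex[of "\<lambda>k. k < e n N v \<and> (offset (e n N) v + k) mod n = i"] by (auto simp: s_def)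
  have "computable (\<lambda>n N. ((X n N, e n N), \<lambda>u. if u < n then
    p n (X n N, e n N) (N u) u (\<lambda>v. if v < n then s n (X n N, e n N) (N v) v u else 0) else {}))"
  proof (rule computable_exchange[OF Xe, where B = B and K = "2 * K + 1"])
    fix n
    show "finite (B n)"
      unfolding B_def by (rule finite_subset[of _ "Pow ({..<n} \<times> {..<n})"]) auto
    have "card (B n) \<le> (n * n + 1) ^ K"
      using card_subsets_le[of "{..<n} \<times> {..<n}" K] by (simp add: B_def)
    also have "\<dots> \<le> ((n + 1) ^ 2) ^ K"
      by (intro power_mono) (auto simp: power2_eq_square)
    also have "\<dots> \<le> (n + 1) ^ (2 * K + 1)"
      unfolding power_mult[symmetric] by (intro power_increasing) auto
    finally show "card (B n) \<le> (n + 1) ^ (2 * K + 1)" .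
  next
    fix n N u v
    assume *: "graph_on n N" "u < n" "v < n"
    have "s n (X n N, e n N) (N v) v u < n + 1"
      using s_cases[of n N v u] item_less[OF *(1,3)] by auto
    also have "\<dots> \<le> (n + 1) ^ (2 * K + 1)"
      using power_increasing[of 1 "2 * K + 1" "n + 1"] by simp
    finally show "s n (X n N, e n N) (N v) v u < (n + 1) ^ (2 * K + 1)" .
  next
    fix n N u
    assume *: "graph_on n N" "u < n"
    let ?P = "p n (X n N, e n N) (N u) u (\<lambda>v. if v < n then s n (X n N, e n N) (N v) v u else 0)"
    let ?R = "{(v, k). v < n \<and> k < e n N v \<and> (offset (e n N) v + k) mod n = u}"
    have "(\<Sum>v<n. e n N v) \<le> K * n" "0 < n"
      using total[OF *(1)] * by (auto simp: e_def)
    note R = card_route_le[OF this, of u]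
    have P: "?P \<subseteq> (\<lambda>(v, k). (v, item n (X n N, e n N) (N v) v k)) ` ?R"
    proof clarify
      fix v w
      assume "(v, w) \<in> ?P"
      then have "v < n" "s n (X n N, e n N) (N v) v u = Suc w"
        by (auto simp: p_def)
      then show "(v, w) \<in> (\<lambda>(v, k). (v, item n (X n N, e n N) (N v) v k)) ` ?R"
        using s_cases[of n N v u] by force
    qed
    then have "card ?P \<le> K"
      using R surj_card_le[OF R(1) P] by linarith
    moreover have "?P \<subseteq> {..<n} \<times> {..<n}"
      using P item_less[OF *(1)] by fastforce
    ultimately show "?P \<in> B n"
      by (simp add: B_def)
  qed
  then have "computable (\<lambda>n N. (\<lambda>n ((x, e), c). (x, \<lambda>v. if v < n then {w. \<exists>u<n. (v, w) \<in> c u} else {})) n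
    ((X n N, e n N), \<lambda>u. if u < n then
    p n (X n N, e n N) (N u) u (\<lambda>v. if v < n then s n (X n N, e n N) (N v) v u else 0) else {}))"
    by (rule computable_map)
  then show ?thesis
  proof (rule computable_cong)
    fix n N
    assume *: "graph_on n N"
    have "E n (X n N) (N v) v = {w. \<exists>u<n. s n (X n N, e n N) (N v) v u = Suc w}" if v: "v < n" for v
    proof -
      have "\<exists>u<n. s n (X n N, e n N) (N v) v u = Suc w" if w: "w \<in> E n (X n N) (N v) v" for w
      proof -
        obtain k where k: "k < e n N v" "w = item n (X n N, e n N) (N v) v k"
          using w unfolding set_item[OF * v, symmetric] by auto
        let ?u = "(offset (e n N) v + k) mod n"
        have "?u < n"
          using v by simp
        from s_cases[of n N v ?u] k obtain l where l: "l < e n N v"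
          "(offset (e n N) v + l) mod n = ?u"
          "s n (X n N, e n N) (N v) v ?u = Suc (item n (X n N, e n N) (N v) v l)"
          by auto
        \<comment> \<open>With at most \<open>n\<close> items at \<open>v\<close>, no two are sent
          to the same machine, so the choice of \<open>k\<close> in \<open>s\<close> loses
          none.\<close>
        have "e n N v \<le> n"
          using sub[OF * v] card_mono[of "{..<n}" "E n (X n N) (N v) v"] v by (simp add: e_def)
        then have "l = k"
          using l(1,2) k(1) by (intro offset_mod_inj[of "offset (e n N) v" l n k]) auto
        then show ?thesis
          using l k \<open>?u < n\<close> by auto
      qed
      moreover have "w \<in> E n (X n N) (N v) v" if "s n (X n N, e n N) (N v) v u = Suc w" for u w
        using s_cases[of n N v u] that set_item[OF * v] by auto
      ultimately show ?thesis
        by blast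
    qed
    then show "(X n N, \<lambda>v. if v < n then E n (X n N) (N v) v else {}) =
      (\<lambda>n ((x, e), c). (x, \<lambda>v. if v < n then {w. \<exists>u<n. (v, w) \<in> c u} else {})) n
      ((X n N, e n N), \<lambda>u. if u < n then
        p n (X n N, e n N) (N u) u (\<lambda>v. if v < n then s n (X n N, e n N) (N v) v u else 0) else {})"
      by (auto simp: p_def fun_eq_iff)
  qed
qed

section \<open>Derandomization\<close>

lemma pmf_expectation_le_exists:
  fixes g :: "'b \<Rightarrow> real"
  assumes "finite (set_pmf D)" "measure_pmf.expectation D g < c"
  shows "\<exists>s\<in>set_pmf D. g s < c"
proof (rule ccontr)
  assume "\<not> ?thesis"
  then have "c \<le> measure_pmf.expectation D g"
    using assms(1)
    by (intro measure_pmf.integral_ge_const integrable_measure_pmf_finite) (auto simp: AE_measure_pmf_iff)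
  with assms(2) show False
    by simp
qed

text \<open>
  The union bound over \<open>F\<close> is taken inside the expectation of \<open>\<Sum>f\<in>F. exp (\<dots>)\<close>, and
  \<open>exp x \<le> 1 + 2 x\<close> on the unit interval bounds the moment generating functions.
\<close>

lemma exists_sample_family:
  fixes F :: "('b \<Rightarrow> real) set" and D :: "'b pmf"
  assumes D: "finite (set_pmf D)" and F: "finite F" "real (card F) < exp t"
    and unit: "\<And>f s. f \<in> F \<Longrightarrow> s \<in> set_pmf D \<Longrightarrow> 0 \<le> f s \<and> f s \<le> 1"
  shows "\<exists>\<omega> :: nat \<Rightarrow> 'b. (\<forall>j<m. \<omega> j \<in> set_pmf D) \<and>
    (\<forall>f\<in>F. (\<Sum>j<m. f (\<omega> j)) \<le> 2 * real m * measure_pmf.expectation D f + t)"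
proof -
  define P where "P = Pi_pmf {..<m} undefined (\<lambda>_. D)"
  have P: "finite (set_pmf P)"
    unfolding P_def using D by (subst set_Pi_pmf) auto
  let ?E = "measure_pmf.expectation"
  have mgf: "?E P (\<lambda>\<omega>. exp (\<Sum>j<m. f (\<omega> j))) \<le> exp (2 * real m * ?E D f)" if f: "f \<in> F" for f
  proof -
    have "?E P (\<lambda>\<omega>. exp (\<Sum>j<m. f (\<omega> j))) = ?E P (\<lambda>\<omega>. \<Prod>j<m. exp (f (\<omega> j)))"
      by (simp add: exp_sum)
    also have "\<dots> = (\<Prod>j<m. ?E D (\<lambda>s. exp (f s)))"
      unfolding P_def
      by (rule expectation_prod_Pi_pmf) (auto intro: integrable_measure_pmf_finite D)
    also have "\<dots> = ?E D (\<lambda>s. exp (f s)) ^ m"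
      by simp
    also have "\<dots> \<le> exp (2 * ?E D f) ^ m"
    proof (rule power_mono)
      have "?E D (\<lambda>s. exp (f s)) \<le> ?E D (\<lambda>s. 1 + 2 * f s)"
      proof (rule integral_mono_AE)
        have "exp (f s) \<le> 1 + 2 * f s" if "s \<in> set_pmf D" for s
        proof -
          have "exp (f s) \<le> 1 + f s + (f s)\<^sup>2"
            using unit[OF f that] by (intro exp_bound) auto
          moreover have "(f s)\<^sup>2 \<le> f s"
            using unit[OF f that] by (simp add: power2_eq_square mult_left_le)
          ultimately show ?thesis
            by simp
        qed
        then show "AE s in measure_pmf D. exp (f s) \<le> 1 + 2 * f s"
          by (simp add: AE_measure_pmf_iff)
      qed (intro integrable_measure_pmf_finite D)+
      also have "\<dots> = 1 + 2 * ?E D f"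
        by (subst Bochner_Integration.integral_add) (auto intro: integrable_measure_pmf_finite D)
      also have "\<dots> \<le> exp (2 * ?E D f)"
        by (rule exp_ge_add_one_self)
      finally show "?E D (\<lambda>s. exp (f s)) \<le> exp (2 * ?E D f)" .
    qed (auto intro: Bochner_Integration.integral_nonneg)
    also have "\<dots> = exp (2 * real m * ?E D f)"
      by (simp add: mult_ac flip: exp_of_nat_mult)
    finally show ?thesis .
  qed
  \<comment> \<open>The mean of \<open>g\<close> is at most \<open>card F\<close>, hence some
    \<open>\<omega>\<close> has \<open>g \<omega> < exp t\<close>; the summands are positive, so
    each of them is below \<open>exp t\<close> too.\<close>
  define g where "g = (\<lambda>\<omega>. \<Sum>f\<in>F. exp (\<Sum>j<m. f (\<omega> j)) * exp (- (2 * real m * ?E D f)))"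
  have "?E P g = (\<Sum>f\<in>F. ?E P (\<lambda>\<omega>. exp (\<Sum>j<m. f (\<omega> j))) * exp (- (2 * real m * ?E D f)))"
    unfolding g_def
    by (subst Bochner_Integration.integral_sum) (auto intro: integrable_measure_pmf_finite P)
  also have "\<dots> \<le> (\<Sum>f\<in>F. exp (2 * real m * ?E D f) * exp (- (2 * real m * ?E D f)))"
    by (intro sum_mono mult_right_mono mgf) auto
  also have "\<dots> = real (card F)"
    by (simp flip: exp_add)
  also have "\<dots> < exp t"
    by fact
  finally obtain \<omega> where \<omega>: "\<omega> \<in> set_pmf P" "g \<omega> < exp t"
    using pmf_expectation_le_exists[OF P] by blast
  have "(\<Sum>j<m. f (\<omega> j)) \<le> 2 * real m * ?E D f + t" if "f \<in> F" for f
  proof -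
    have "exp (\<Sum>j<m. f (\<omega> j)) * exp (- (2 * real m * ?E D f)) \<le> g \<omega>"
      unfolding g_def by (rule member_le_sum) (use that F in auto)
    then have "exp ((\<Sum>j<m. f (\<omega> j)) + - (2 * real m * ?E D f)) < exp t"
      using \<omega>(2) unfolding exp_add by linarith
    then show ?thesis
      by simp
  qed
  moreover have "\<omega> j \<in> set_pmf D" if "j < m" for j
    using \<omega>(1) that by (auto simp: P_def set_Pi_pmf PiE_dflt_def)
  ultimately show ?thesis
    by blast
qed

text \<open>For each \<open>n\<close> and each public value \<open>x\<close> a list of outcomes is
  fixed whose average cost is at most twice the expectation plus a constant, for all vertices and
  neighbourhoods with bounded costs at once. The list depends on the graph through \<open>x\<close>
  alone, so only the index of a good outcome has to be found by communication.\<close>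

lemma computable_derandomize:
  fixes D :: "nat \<Rightarrow> 'a \<Rightarrow> 'b pmf" and f :: "nat \<Rightarrow> 'a \<Rightarrow> nat set \<Rightarrow> nat \<Rightarrow> 'b \<Rightarrow> real"
  assumes X: "computable X"
    and D: "\<And>n x. finite (set_pmf (D n x))"
    and bound: "\<And>n N v s. graph_on n N \<Longrightarrow> v < n \<Longrightarrow> s \<in> set_pmf (D n (X n N)) \<Longrightarrow>
      0 \<le> f n (X n N) (N v) v s \<and> f n (X n N) (N v) v s \<le> (real n + 1) ^ b"
    and cost: "\<And>n N. graph_on n N \<Longrightarrow>
      (\<Sum>v<n. measure_pmf.expectation (D n (X n N)) (f n (X n N) (N v) v)) \<le> e * real n"
  shows "\<exists>S C. computable (\<lambda>n N. (X n N, S n N)) \<and>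
    (\<forall>n N. graph_on n N \<longrightarrow> S n N \<in> set_pmf (D n (X n N)) \<and>
      (\<Sum>v<n. f n (X n N) (N v) v (S n N)) \<le> C * real n)"
proof -
  let ?E = "measure_pmf.expectation"
  \<comment> \<open>Costs are assumed to be bounded for actual neighbourhoods only, while the
    outcomes have to be fixed for all sets \<open>A\<close>; \<open>ok\<close> singles out those
    with bounded costs.\<close>
  define ok where "ok = (\<lambda>n x A v. \<forall>s\<in>set_pmf (D n x). 0 \<le> f n x A v s \<and> f n x A v s \<le> (real n + 1) ^ b)"
  \<comment> \<open>So many outcomes make the error \<open>2 * real n * (real n + 1) ^ b\<close>
    constant on average: divided by \<open>n ^ (b + 1)\<close> it is at most
    \<open>2 ^ (b + 1)\<close>.\<close>
  define m where "m = (\<lambda>n :: nat. n ^ (b + 1))"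
  have "\<exists>\<omega> :: nat \<Rightarrow> 'b. (\<forall>j<m n. \<omega> j \<in> set_pmf (D n x)) \<and>
    (\<forall>v<n. \<forall>A\<subseteq>{..<n}. ok n x A v \<longrightarrow> (\<Sum>j<m n. f n x A v (\<omega> j))
      \<le> 2 * real (m n) * ?E (D n x) (f n x A v) + 2 * real n * (real n + 1) ^ b)"
    if n: "0 < n" for n x
  proof -
    let ?c = "(real n + 1) ^ b"
    \<comment> \<open>There are at most \<open>n * 2 ^ n\<close> such pairs, fewer than
      \<open>exp (2 * n)\<close>, so the union bound works with \<open>t = 2 * n\<close>.\<close>
    define I where "I = {(v, A). v < n \<and> A \<subseteq> {..<n} \<and> ok n x A v}"
    define F where "F = (\<lambda>(v, A) s. f n x A v s / ?c) ` I"
    have I: "I \<subseteq> {..<n} \<times> Pow {..<n}"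
      by (auto simp: I_def)
    have fin: "finite I"
      by (rule finite_subset[OF I]) auto
    have "card F \<le> card I"
      unfolding F_def by (rule card_image_le[OF fin])
    also have "\<dots> \<le> card ({..<n} \<times> Pow {..<n})"
      by (rule card_mono[OF _ I]) auto
    finally have "real (card F) \<le> real (card ({..<n} \<times> Pow {..<n}))"
      by (rule of_nat_mono)
    also have "\<dots> = real n * 2 ^ n"
      by (simp add: card_cartesian_product card_Pow)
    also have "\<dots> < 2 ^ n * 2 ^ n"
      by (intro mult_strict_right_mono of_nat_less_two_power) auto
    also have "\<dots> \<le> exp 1 ^ n * exp 1 ^ n"
      using exp_ge_add_one_self[of 1] by (intro mult_mono power_mono) auto
    also have "\<dots> = exp (2 * real n)"
      by (simp flip: exp_of_nat_mult exp_add)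
    finally have "real (card F) < exp (2 * real n)" .
    moreover have "finite F"
      unfolding F_def using fin by (rule finite_imageI)
    moreover have "0 \<le> g s \<and> g s \<le> 1" if "g \<in> F" "s \<in> set_pmf (D n x)" for g s
      using that by (auto simp: F_def I_def ok_def)
    ultimately obtain \<omega> where \<omega>: "\<forall>j<m n. \<omega> j \<in> set_pmf (D n x)"
      "\<forall>f\<in>F. (\<Sum>j<m n. f (\<omega> j)) \<le> 2 * real (m n) * ?E (D n x) f + 2 * real n"
      using exists_sample_family[OF D, of F "2 * real n" n x "m n"] by blast
    have "(\<Sum>j<m n. f n x A v (\<omega> j)) \<le> 2 * real (m n) * ?E (D n x) (f n x A v) + 2 * real n * ?c"
      if "v < n" "A \<subseteq> {..<n}" "ok n x A v" for v A
    proof -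
      have "(\<lambda>s. f n x A v s / ?c) \<in> F"
        using that by (force simp: F_def I_def)
      from bspec[OF \<omega>(2) this]
      have "(\<Sum>j<m n. f n x A v (\<omega> j) / ?c) \<le> 2 * real (m n) * ?E (D n x) (\<lambda>s. f n x A v s / ?c) + 2 * real n" .
      then have "(\<Sum>j<m n. f n x A v (\<omega> j)) / ?c \<le> (2 * real (m n) * ?E (D n x) (f n x A v)) / ?c + 2 * real n"
        by (simp add: sum_divide_distrib)
      then show ?thesis
        by (simp add: field_simps)
    qed
    with \<omega>(1) show ?thesis
      by blast
  qed
  then obtain \<omega> :: "nat \<Rightarrow> 'a \<Rightarrow> nat \<Rightarrow> 'b" where
    \<omega>: "\<And>n x j. 0 < n \<Longrightarrow> j < m n \<Longrightarrow> \<omega> n x j \<in> set_pmf (D n x)"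
    and \<omega>_sum: "\<And>n x v A. 0 < n \<Longrightarrow> v < n \<Longrightarrow> A \<subseteq> {..<n} \<Longrightarrow> ok n x A v \<Longrightarrow>
      (\<Sum>j<m n. f n x A v (\<omega> n x j))
        \<le> 2 * real (m n) * ?E (D n x) (f n x A v) + 2 * real n * (real n + 1) ^ b"
    by metis
  \<comment> \<open>Rounding up to integers adds at most 1 per vertex, which is \<open>n\<close> in
    total for each outcome.\<close>
  define c where "c = (\<lambda>n x A v j. nat \<lceil>f n x A v (\<omega> n x j)\<rceil>)"
  have c_ge: "f n x A v (\<omega> n x j) \<le> real (c n x A v j)" for n x A v j
    unfolding c_def by (rule real_nat_ceiling_ge)
  have c_le: "real (c n (X n N) (N v) v j) \<le> f n (X n N) (N v) v (\<omega> n (X n N) j) + 1"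
    if "graph_on n N" "v < n" "j < m n" for n N v j
    using bound[OF that(1,2) \<omega>[OF _ that(3)]] that unfolding c_def by linarith
  have "c n (X n N) (N v) v j \<le> (n + 1) ^ b" if "graph_on n N" "v < n" "j < n ^ (b + 1)" for n N v j
  proof -
    have "f n (X n N) (N v) v (\<omega> n (X n N) j) \<le> (real n + 1) ^ b"
      using bound[OF that(1,2) \<omega>] that by (auto simp: m_def)
    also have "\<dots> = real_of_int (int ((n + 1) ^ b))"
      by (simp add: add.commute)
    finally have "\<lceil>f n (X n N) (N v) v (\<omega> n (X n N) j)\<rceil> \<le> int ((n + 1) ^ b)"
      by (simp only: ceiling_le_iff)
    then show ?thesis
      unfolding c_def by linarith
  qed
  from computable_select[where f = c, OF X this] obtain J where J: "computable (\<lambda>n N. (X n N, J n N))"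
    and J': "\<And>n N. graph_on n N \<Longrightarrow> 0 < n \<Longrightarrow> J n N < m n \<and>
      m n * (\<Sum>v<n. c n (X n N) (N v) v (J n N)) \<le> (\<Sum>j<m n. \<Sum>v<n. c n (X n N) (N v) v j)"
    unfolding m_def by blast
  \<comment> \<open>For \<open>n = 0\<close> the list of outcomes is empty, and any member of the
    support will do.\<close>
  define S where "S = (\<lambda>n N. if n = 0 then SOME s. s \<in> set_pmf (D n (X n N)) else \<omega> n (X n N) (J n N))"
  have "computable (\<lambda>n N. (\<lambda>n (x, j). (x, if n = 0 then SOME s. s \<in> set_pmf (D n x) else \<omega> n x j)) n
    (X n N, J n N))"
    by (rule computable_map) fact
  then have "computable (\<lambda>n N. (X n N, S n N))"
    by (simp add: S_def)
  moreover have "S n N \<in> set_pmf (D n (X n N)) \<and>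
      (\<Sum>v<n. f n (X n N) (N v) v (S n N)) \<le> (2 * e + 1 + 2 ^ (b + 1)) * real n"
    if N: "graph_on n N" for n N
  proof (cases "n = 0")
    case True
    then show ?thesis
      using some_in_eq[of "set_pmf (D n (X n N))"] by (simp add: S_def set_pmf_not_empty)
  next
    case False
    then have n: "0 < n"
      by simp
    let ?x = "X n N"
    have A: "N v \<subseteq> {..<n}" for v
      using N by (auto simp: graph_on_def)
    have "real (m n) * (\<Sum>v<n. f n ?x (N v) v (S n N)) \<le> real (m n) * (\<Sum>v<n. real (c n ?x (N v) v (J n N)))"
      using n by (intro mult_left_mono sum_mono) (auto simp: S_def c_ge)
    also have "\<dots> = real (m n * (\<Sum>v<n. c n ?x (N v) v (J n N)))"
      by simp
    also have "\<dots> \<le> real (\<Sum>j<m n. \<Sum>v<n. c n ?x (N v) v j)"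
      using J'[OF N n] by (intro of_nat_mono) blast
    also have "\<dots> = (\<Sum>j<m n. \<Sum>v<n. real (c n ?x (N v) v j))"
      by simp
    also have "\<dots> \<le> (\<Sum>j<m n. \<Sum>v<n. f n ?x (N v) v (\<omega> n ?x j) + 1)"
      by (intro sum_mono c_le N) auto
    also have "\<dots> = (\<Sum>v<n. \<Sum>j<m n. f n ?x (N v) v (\<omega> n ?x j)) + real (m n) * real n"
      by (subst (2) sum.swap) (simp add: sum.distrib mult.commute)
    also have "\<dots> \<le> (\<Sum>v<n. 2 * real (m n) * ?E (D n ?x) (f n ?x (N v) v) + 2 * real n * (real n + 1) ^ b)
        + real (m n) * real n"
      using bound[OF N] by (intro add_right_mono sum_mono \<omega>_sum n A) (auto simp: ok_def)
    also have "\<dots> = 2 * real (m n) * (\<Sum>v<n. ?E (D n ?x) (f n ?x (N v) v))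
        + 2 * real n * (real n * (real n + 1) ^ b) + real (m n) * real n"
      by (simp add: sum.distrib sum_distrib_left mult_ac)
    also have "\<dots> \<le> 2 * real (m n) * (e * real n) + 2 * real n * (real (m n) * 2 ^ b) + real (m n) * real n"
    proof (intro add_mono mult_left_mono cost N)
      have "(real n + 1) ^ b \<le> (real n * 2) ^ b"
        using n by (intro power_mono) auto
      then have "real n * (real n + 1) ^ b \<le> real n * (real n * 2) ^ b"
        by (rule mult_left_mono) simp
      then show "real n * (real n + 1) ^ b \<le> real (m n) * 2 ^ b"
        by (simp add: m_def power_mult_distrib)
    qed auto
    also have "\<dots> = real (m n) * ((2 * e + 1 + 2 ^ (b + 1)) * real n)"
      by (simp add: algebra_simps)
    finally have "(\<Sum>v<n. f n ?x (N v) v (S n N)) \<le> (2 * e + 1 + 2 ^ (b + 1)) * real n"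
      using n by (subst (asm) mult_le_cancel_left_pos) (auto simp: m_def)
    moreover have "S n N \<in> set_pmf (D n ?x)"
      using n \<omega> J'[OF N n] by (simp add: S_def)
    ultimately show ?thesis
      by blast
  qed
  ultimately show ?thesis
    by blast
qed

section \<open>Random vertex sets with independent members\<close>

definition bernoulli_subset :: "nat \<Rightarrow> (nat \<Rightarrow> real) \<Rightarrow> nat set pmf" where
  "bernoulli_subset n p =
     map_pmf (\<lambda>s. {u. u < n \<and> s u}) (Pi_pmf {..<n} False (\<lambda>u. bernoulli_pmf (p u)))"

lemma finite_set_bernoulli_subset: "finite (set_pmf (bernoulli_subset n p))"
  by (rule finite_subset[of _ "Pow {..<n}"]) (auto simp: bernoulli_subset_def)

lemma bernoulli_subset_support:
  assumes "S \<in> set_pmf (bernoulli_subset n p)" "u \<in> S"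
  shows "u < n" "p u \<noteq> 0"
proof -
  obtain s where s: "s \<in> set_pmf (Pi_pmf {..<n} False (\<lambda>u. bernoulli_pmf (p u)))"
    "S = {u. u < n \<and> s u}"
    using assms(1) by (auto simp: bernoulli_subset_def)
  then show "u < n"
    using assms(2) by simp
  have "s \<in> PiE_dflt {..<n} False (\<lambda>u. set_pmf (bernoulli_pmf (p u)))"
    using s(1) set_Pi_pmf_subset'[of "{..<n}" False "\<lambda>u. bernoulli_pmf (p u)"] by (simp add: comp_def subset_iff)
  then have "s u \<in> set_pmf (bernoulli_pmf (p u))"
    using \<open>u < n\<close> unfolding PiE_dflt_def by blast
  moreover have "s u"
    using s(2) assms(2) by simp
  ultimately have "pmf (bernoulli_pmf (p u)) True \<noteq> 0"
    by (simp add: set_pmf_iff)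
  then show "p u \<noteq> 0"
    by (metis bernoulli_pmf.rep_eq mult.commute order.refl pmf_bernoulli_True zero_le_one)
qed

lemma prob_superset_bernoulli_subset:
  assumes "A \<subseteq> {..<n}" "\<And>u. u \<in> A \<Longrightarrow> 0 \<le> p u \<and> p u \<le> 1"
  shows "measure_pmf.prob (bernoulli_subset n p) {S. A \<subseteq> S} = (\<Prod>u\<in>A. p u)"
proof -
  have "measure_pmf.prob (bernoulli_subset n p) {S. A \<subseteq> S} =
    measure_pmf.prob (Pi_pmf {..<n} False (\<lambda>u. bernoulli_pmf (p u)))
      (Pi {..<n} (\<lambda>u. if u \<in> A then {True} else UNIV))"
    using assms(1) by (auto simp: bernoulli_subset_def Pi_iff subset_iff disjoint_iff split: if_splits
        intro!: arg_cong[where f = "measure_pmf.prob _"])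
  also have "\<dots> = (\<Prod>u<n. if u \<in> A then p u else 1)"
    using assms(2)
    by (subst measure_Pi_pmf_Pi) (auto intro!: prod.cong simp: measure_pmf_single)
  also have "\<dots> = (\<Prod>u\<in>A. p u)"
    using assms(1) by (simp add: prod.If_cases Int_absorb1)
  finally show ?thesis .
qed

lemma prob_disjoint_bernoulli_subset:
  assumes "A \<subseteq> {..<n}" "\<And>u. u \<in> A \<Longrightarrow> 0 \<le> p u \<and> p u \<le> 1"
  shows "measure_pmf.prob (bernoulli_subset n p) {S. A \<inter> S = {}} \<le> exp (- (\<Sum>u\<in>A. p u))"
proof -
  have "measure_pmf.prob (bernoulli_subset n p) {S. A \<inter> S = {}} =
    measure_pmf.prob (Pi_pmf {..<n} False (\<lambda>u. bernoulli_pmf (p u)))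
      (Pi {..<n} (\<lambda>u. if u \<in> A then {False} else UNIV))"
    using assms(1) by (auto simp: bernoulli_subset_def Pi_iff subset_iff disjoint_iff split: if_splits
        intro!: arg_cong[where f = "measure_pmf.prob _"])
  also have "\<dots> = (\<Prod>u<n. if u \<in> A then 1 - p u else 1)"
    using assms(2)
    by (subst measure_Pi_pmf_Pi) (auto intro!: prod.cong simp: measure_pmf_single)
  also have "\<dots> = (\<Prod>u\<in>A. 1 - p u)"
    using assms(1) by (simp add: prod.If_cases Int_absorb1)
  also have "\<dots> \<le> (\<Prod>u\<in>A. exp (- p u))"
  proof (rule prod_mono)
    fix u
    assume "u \<in> A"
    then show "0 \<le> 1 - p u \<and> 1 - p u \<le> exp (- p u)"
      using assms(2) exp_ge_add_one_self[of "- p u"] by auto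
  qed
  also have "\<dots> = exp (- (\<Sum>u\<in>A. p u))"
    using assms(1) by (simp add: exp_sum sum_negf[symmetric] finite_subset[OF assms(1)])
  finally show ?thesis .
qed

section \<open>Dominated vertices and maximal independent sets\<close>

text \<open>Linearity of expectation over the pairs of \<open>v\<close> with a member of
  \<open>A\<close>; since \<open>v \<notin> A\<close>, the two ends of a pair are sampled
  independently.\<close>

lemma expectation_edges_bernoulli_subset:
  assumes "A \<subseteq> {..<n}" "v < n" "v \<notin> A" and p: "\<And>u. 0 \<le> p u \<and> p u \<le> 1"
  shows "measure_pmf.expectation (bernoulli_subset n p) (\<lambda>S. if v \<in> S then real (card (A \<inter> S)) else 0)
    = p v * (\<Sum>u\<in>A. p u)"
proof -
  have fin: "finite A"
    using assms(1) by (rule finite_subset) simp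
  have "(if v \<in> S then real (card (A \<inter> S)) else 0) = (\<Sum>u\<in>A. indicator {S. {v, u} \<subseteq> S} S)" for S
    using fin by (auto simp: indicator_def sum.If_cases Int_def)
  then have "measure_pmf.expectation (bernoulli_subset n p) (\<lambda>S. if v \<in> S then real (card (A \<inter> S)) else 0)
    = (\<Sum>u\<in>A. measure_pmf.prob (bernoulli_subset n p) {S. {v, u} \<subseteq> S})"
    by (simp add: Bochner_Integration.integral_sum integrable_measure_pmf_finite finite_set_bernoulli_subset)
  also have "\<dots> = (\<Sum>u\<in>A. p v * p u)"
  proof (rule sum.cong)
    fix u
    assume "u \<in> A"
    then have "v \<noteq> u" "{v, u} \<subseteq> {..<n}"
      using assms by auto
    then show "measure_pmf.prob (bernoulli_subset n p) {S. {v, u} \<subseteq> S} = p v * p u"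
      using p by (subst prob_superset_bernoulli_subset) auto
  qed simp
  finally show ?thesis
    by (simp add: sum_distrib_left)
qed

lemma expectation_disjoint_bernoulli_subset:
  assumes "A \<subseteq> {..<n}" and p: "\<And>u. 0 \<le> p u \<and> p u \<le> 1" and "0 \<le> c"
  shows "measure_pmf.expectation (bernoulli_subset n p) (\<lambda>S. if A \<inter> S = {} then c else 0)
    \<le> c * exp (- (\<Sum>u\<in>A. p u))"
proof -
  have "(if A \<inter> S = {} then c else 0) = c * indicator {S. A \<inter> S = {}} S" for S
    by (simp add: indicator_def)
  then show ?thesis
    using prob_disjoint_bernoulli_subset[OF assms(1), of p] p assms(3)
    by (simp add: mult_left_mono)
qed

text \<open>A single term of the exponential series.\<close>

lemma power_le_fact_mult_exp:
  assumes "0 \<le> (x :: real)"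
  shows "x ^ k \<le> fact k * exp x"
proof -
  have "(\<Sum>i\<in>{k}. inverse (fact i) *\<^sub>R x ^ i) \<le> (\<Sum>i. inverse (fact i) *\<^sub>R x ^ i)"
    using assms by (intro sum_le_suminf summable_exp_generic) auto
  then have "x ^ k / fact k \<le> exp x"
    by (simp add: exp_def field_simps)
  then show ?thesis
    by (simp add: field_simps)
qed

definition independent_in :: "(nat \<Rightarrow> nat set) \<Rightarrow> nat set \<Rightarrow> bool" where
  "independent_in N M \<longleftrightarrow> (\<forall>v\<in>M. N v \<inter> M = {})"

text \<open>These vertices are at distance more than two from \<open>M\<close> and still have to be
  ruled. None of them has a neighbour in \<open>M\<close>, so an independent set of them can be
  added to \<open>M\<close>.\<close>

definition far :: "nat \<Rightarrow> (nat \<Rightarrow> nat set) \<Rightarrow> nat set \<Rightarrow> nat set" where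
  "far n N M = {v. v < n \<and> v \<notin> M \<and> N v \<inter> M = {} \<and> (\<forall>w\<in>N v. N w \<inter> M = {})}"

lemma far_antimono: "M \<subseteq> M' \<Longrightarrow> far n N M' \<subseteq> far n N M"
  by (auto simp: far_def)

lemma finite_far: "finite (far n N M)"
  by (simp add: far_def)

lemma independent_in_Un_far:
  assumes "graph_on n N" "independent_in N M" "independent_in N I" "I \<subseteq> far n N M"
  shows "independent_in N (M \<union> I)"
  using assms by (fastforce simp: independent_in_def far_def graph_on_def)

text \<open>Two rounds of flags: first the vertices with a neighbour in \<open>M\<close> are
  announced, then those that are neither in \<open>M\<close> nor announced before nor adjacent to a
  vertex announced before.\<close>

lemma computable_far:
  assumes "computable (\<lambda>n N. (X n N, M n N))"
  shows "computable (\<lambda>n N. ((X n N, M n N), far n N (M n N)))"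
proof -
  let ?D = "\<lambda>n N. {v. v < n \<and> N v \<inter> M n N \<noteq> {}}"
  have "computable (\<lambda>n N. ((X n N, M n N), ?D n N))"
    using computable_flags[OF assms, of "\<lambda>n x A v. A \<inter> snd x \<noteq> {}"] by simp
  from computable_flags[OF this, of "\<lambda>n ((x, m), d) A v. v \<notin> m \<and> v \<notin> d \<and> A \<inter> d = {}"]
  have "computable (\<lambda>n N. (((X n N, M n N), ?D n N),
      {v. v < n \<and> (v \<notin> M n N \<and> v \<notin> ?D n N \<and> N v \<inter> ?D n N = {})}))"
    by (simp only: prod.case)
  then have "computable (\<lambda>n N. (\<lambda>n ((x, d), y). (x, y)) n (((X n N, M n N), ?D n N),
      {v. v < n \<and> (v \<notin> M n N \<and> v \<notin> ?D n N \<and> N v \<inter> ?D n N = {})}))"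
    by (rule computable_map)
  then show ?thesis
    by (rule computable_cong) (fastforce simp: far_def graph_on_def)
qed

definition is_mis :: "(nat \<Rightarrow> nat \<Rightarrow> bool) \<Rightarrow> nat set \<Rightarrow> nat set \<Rightarrow> bool" where
  "is_mis adj S M \<longleftrightarrow> M \<subseteq> S \<and> (\<forall>u\<in>M. \<forall>v\<in>M. \<not> adj u v) \<and> (\<forall>v\<in>S. v \<in> M \<or> (\<exists>u\<in>M. adj v u))"

lemma exists_mis:
  assumes "finite S" "\<And>u. \<not> adj u u" "\<And>u v. adj u v \<Longrightarrow> adj v u"
  shows "\<exists>M. is_mis adj S M"
  using assms(1)
proof induction
  case empty
  then show ?case
    by (simp add: is_mis_def)
next
  case (insert x S)
  then obtain M where M: "is_mis adj S M"
    by blast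
  have "is_mis adj (insert x S) (if \<exists>u\<in>M. adj x u then M else insert x M)"
    using M assms(2,3) unfolding is_mis_def by auto
  then show ?case ..
qed

text \<open>The edges inside \<open>S\<close> are made public, and all machines determine the same
  maximal independent set \<open>I\<close> of the subgraph on \<open>S\<close>. Every vertex of
  \<open>S\<close> is in \<open>I\<close> or next to it, so whoever is in \<open>S\<close> or next
  to \<open>S\<close> becomes ruled. The relation \<open>r\<close> says which end reports an edge:
  at least one end does, and \<open>edges\<close> bounds the number of reports.\<close>

lemma computable_extend:
  assumes XM: "computable (\<lambda>n N. (X n N, M n N))"
    and S: "\<And>n N. graph_on n N \<Longrightarrow> S n (X n N) (M n N) \<subseteq> far n N (M n N)"
    and M: "\<And>n N. graph_on n N \<Longrightarrow> M n N \<subseteq> {..<n} \<and> independent_in N (M n N)"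
    and r: "\<And>n N u v. graph_on n N \<Longrightarrow> u \<in> N v \<Longrightarrow> r n (X n N) u v \<or> r n (X n N) v u"
    and edges: "\<And>n N. graph_on n N \<Longrightarrow>
      real (\<Sum>v\<in>S n (X n N) (M n N). card {u \<in> N v \<inter> S n (X n N) (M n N). r n (X n N) v u}) \<le> C * real n"
  shows "\<exists>M'. computable (\<lambda>n N. (X n N, M' n N)) \<and> (\<forall>n N. graph_on n N \<longrightarrow>
    M n N \<subseteq> M' n N \<and> M' n N \<subseteq> {..<n} \<and> independent_in N (M' n N) \<and>
    (\<forall>v\<in>far n N (M' n N). v \<notin> S n (X n N) (M n N) \<and> N v \<inter> S n (X n N) (M n N) = {}))"
proof -
  define T where "T = (\<lambda>n N. S n (X n N) (M n N))"
  define I where "I = (\<lambda>n N. SOME I. is_mis (\<lambda>u v. u \<in> N v \<and> u \<in> T n N \<and> v \<in> T n N) (T n N) I)"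
  define E where "E = (\<lambda>n (x, m) A v. if v \<in> S n x m then {u \<in> A \<inter> S n x m. r n x v u} else {})"
  have T: "T n N \<subseteq> {..<n}" if "graph_on n N" for n N
    using S[OF that] by (auto simp: T_def far_def)
  have "computable (\<lambda>n N. ((X n N, M n N), \<lambda>v. if v < n then E n (X n N, M n N) (N v) v else {}))"
  proof (rule computable_gather[OF XM, where K = "nat \<lceil>C\<rceil>"])
    fix n N v
    assume N: "graph_on n N"
    show "E n (X n N, M n N) (N v) v \<subseteq> {..<n}"
      using N by (auto simp: E_def graph_on_def)
  next
    fix n N
    assume N: "graph_on n N"
    have "(\<Sum>v<n. card (E n (X n N, M n N) (N v) v)) = (\<Sum>v\<in>T n N. card {u \<in> N v \<inter> T n N. r n (X n N) v u})"
      using T[OF N] by (intro sum.mono_neutral_cong_right) (auto simp: E_def T_def)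
    then have "real (\<Sum>v<n. card (E n (X n N, M n N) (N v) v)) \<le> C * real n"
      using edges[OF N] by (simp add: T_def)
    also have "\<dots> \<le> real (nat \<lceil>C\<rceil>) * real n"
      by (intro mult_right_mono real_nat_ceiling_ge) simp
    finally show "(\<Sum>v<n. card (E n (X n N, M n N) (N v) v)) \<le> nat \<lceil>C\<rceil> * n"
      by (simp only: flip: of_nat_mult of_nat_le_iff[where 'a = real])
  qed
  then have "computable (\<lambda>n N. (\<lambda>n ((x, m), e). (x, m \<union> (SOME I. is_mis (\<lambda>u v. u \<in> e v \<or> v \<in> e u) (S n x m) I))) n
      ((X n N, M n N), \<lambda>v. if v < n then E n (X n N, M n N) (N v) v else {}))"
    by (rule computable_map)
  then have *: "computable (\<lambda>n N. (X n N, M n N \<union> I n N))"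
  proof (rule computable_cong)
    fix n N
    assume N: "graph_on n N"
    \<comment> \<open>An edge may have been reported by one end only; the disjunction restores
      symmetry.\<close>
    have "(u \<in> N v \<and> u \<in> T n N \<and> v \<in> T n N) \<longleftrightarrow> (u \<in> (if v < n then E n (X n N, M n N) (N v) v else {}) \<or>
        v \<in> (if u < n then E n (X n N, M n N) (N u) u else {}))" for u v
      using r[OF N, of u v] N T[OF N] unfolding E_def T_def graph_on_def by auto
    then show "(X n N, M n N \<union> I n N) =
      (\<lambda>n ((x, m), e). (x, m \<union> (SOME I. is_mis (\<lambda>u v. u \<in> e v \<or> v \<in> e u) (S n x m) I))) n
      ((X n N, M n N), \<lambda>v. if v < n then E n (X n N, M n N) (N v) v else {})"
      by (simp add: T_def I_def)
  qed
  have "M n N \<subseteq> M n N \<union> I n N \<and> M n N \<union> I n N \<subseteq> {..<n} \<and> independent_in N (M n N \<union> I n N) \<and>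
      (\<forall>v\<in>far n N (M n N \<union> I n N). v \<notin> T n N \<and> N v \<inter> T n N = {})"
    if N: "graph_on n N" for n N
  proof -
    have "\<exists>I. is_mis (\<lambda>u v. u \<in> N v \<and> u \<in> T n N \<and> v \<in> T n N) (T n N) I"
      by (rule exists_mis) (use N finite_subset[OF T[OF N]] in \<open>auto simp: graph_on_def\<close>)
    then have I: "is_mis (\<lambda>u v. u \<in> N v \<and> u \<in> T n N \<and> v \<in> T n N) (T n N) (I n N)"
      unfolding I_def by (rule someI_ex)
    have sub: "I n N \<subseteq> T n N"
      using I by (simp add: is_mis_def)
    have "independent_in N (I n N)"
      using I sub unfolding is_mis_def independent_in_def by blast
    then have "independent_in N (M n N \<union> I n N)"
      using M[OF N] S[OF N] sub by (intro independent_in_Un_far[OF N]) (auto simp: T_def)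
    moreover have "v \<notin> T n N \<and> N v \<inter> T n N = {}" if v: "v \<in> far n N (M n N \<union> I n N)" for v
    proof -
      have dom: "u \<in> I n N \<or> N u \<inter> I n N \<noteq> {}" if "u \<in> T n N" for u
        using I that N unfolding is_mis_def graph_on_def by blast
      have "v \<notin> I n N" "N v \<inter> I n N = {}" "\<And>u. u \<in> N v \<Longrightarrow> N u \<inter> I n N = {}"
        using v by (auto simp: far_def)
      then show ?thesis
        using dom by blast
    qed
    ultimately show ?thesis
      using M[OF N] sub T[OF N] by blast
  qed
  then show ?thesis
    using * unfolding T_def by (intro exI[of _ "\<lambda>n N. M n N \<union> I n N"]) blast
qed

section \<open>Good and bad vertices\<close>

text \<open>
  The exponent 34 lets all probabilities and thresholds be integer powers of one integer scale;
  no smaller even exponent satisfies the constraints that the stages below impose.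
\<close>

definition degree_scale :: "nat \<Rightarrow> nat" where
  "degree_scale d = nth_root_nat 34 d"

lemma degree_scale_power_le: "degree_scale d ^ 34 \<le> d"
  by (simp add: degree_scale_def nth_root_nat_power_le)

lemma degree_scale_0 [simp]: "degree_scale 0 = 0"
  by (simp add: degree_scale_def)

lemma degree_scale_pos: "0 < d \<Longrightarrow> 1 \<le> degree_scale d"
  using nth_root_nat_mono[of 1 d 34] by (simp add: degree_scale_def)

lemma degree_scale_le: "degree_scale d \<le> d"
proof (cases "d = 0")
  case False
  then have "degree_scale d ^ 1 \<le> degree_scale d ^ 34"
    using degree_scale_pos[of d] by (intro power_increasing) auto
  then show ?thesis
    using degree_scale_power_le[of d] by simp
qed simp

text \<open>Rounding the root down loses a factor of at most 2: a positive \<open>d\<close> is less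
  than \<open>(degree_scale d + 1) ^ 34\<close>, which is at most
  \<open>(2 * degree_scale d) ^ 34\<close>.\<close>

lemma le_scale_power: "real d \<le> 2 ^ 34 * real (degree_scale d) ^ 34"
proof (cases "d = 0")
  case False
  have "d < (degree_scale d + 1) ^ 34"
  proof (rule ccontr)
    assume "\<not> ?thesis"
    then have "degree_scale ((degree_scale d + 1) ^ 34) \<le> degree_scale d"
      unfolding degree_scale_def by (intro nth_root_nat_mono) simp
    moreover have "degree_scale ((degree_scale d + 1) ^ 34) = degree_scale d + 1"
      unfolding degree_scale_def by (rule nth_root_nat_nth_power) simp
    ultimately show False
      by simp
  qed
  also have "\<dots> \<le> (2 * degree_scale d) ^ 34"
    using False degree_scale_pos[of d] by (intro power_mono) auto
  finally have "d \<le> (2 * degree_scale d) ^ 34"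
    by simp
  then have "real d \<le> real ((2 * degree_scale d) ^ 34)"
    by (rule of_nat_mono)
  then show ?thesis
    by (simp add: power_mult_distrib)
qed simp

text \<open>For \<open>k = 0\<close> and \<open>j > 0\<close> the quotient is 0, so that vertices of
  level 0 are never sampled.\<close>

lemma inverse_power_unit: "0 \<le> 1 / real k ^ j \<and> 1 / real k ^ j \<le> 1"
proof (cases "k = 0")
  case False
  then have "1 \<le> real k ^ j"
    by (intro one_le_power) simp
  then show ?thesis
    using False by (intro conjI mult_imp_div_pos_le) auto
qed (cases j; simp)

definition level :: "(nat \<Rightarrow> nat set) \<Rightarrow> nat \<Rightarrow> nat" where
  "level N v = degree_scale (card (N v))"

text \<open>The sum is the expected number of neighbours that the first stage samples.\<close>

definition bad :: "(nat \<Rightarrow> nat set) \<Rightarrow> nat set" where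
  "bad N = {v. (\<Sum>u\<in>N v. 1 / real (level N u) ^ 17) < real (level N v)}"

lemma card_le_level: "real (card (N v)) \<le> 2 ^ 34 * real (level N v) ^ 34"
  unfolding level_def by (rule le_scale_power)

lemma card_nbhd_le: "graph_on n N \<Longrightarrow> card (N v) \<le> n"
  using card_mono[of "{..<n}" "N v"] by (auto simp: graph_on_def)

lemma level_le: "graph_on n N \<Longrightarrow> level N v \<le> n"
  unfolding level_def using degree_scale_le card_nbhd_le by (rule order_trans)

lemma level_nbr_pos:
  assumes "graph_on n N" "u \<in> N v"
  shows "1 \<le> level N u"
proof -
  have "v \<in> N u"
    using assms by (simp add: graph_on_def)
  then have "0 < card (N u)"
    using graph_on_finite[OF assms(1)] by (auto simp: card_gt_0_iff)
  then show ?thesis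
    unfolding level_def by (rule degree_scale_pos)
qed

lemma bad_level_pos: "v \<in> bad N \<Longrightarrow> 1 \<le> level N v"
proof (rule ccontr)
  assume "v \<in> bad N" "\<not> 1 \<le> level N v"
  moreover have "0 \<le> (\<Sum>u\<in>N v. 1 / real (level N u) ^ 17)"
    by (rule sum_nonneg) simp
  ultimately show False
    by (auto simp: bad_def)
qed

lemma bad_less: "graph_on n N \<Longrightarrow> v \<in> bad N \<Longrightarrow> v < n"
proof (rule ccontr)
  assume "graph_on n N" "v \<in> bad N" "\<not> v < n"
  then have "N v = {}"
    by (auto simp: graph_on_def)
  then show False
    using bad_level_pos[OF \<open>v \<in> bad N\<close>] by (simp add: level_def)
qed

lemma computable_base: "computable (\<lambda>n N. (level N, bad N))"
proof -
  have "computable (\<lambda>n N. (0 :: nat, \<lambda>u. if u < n then card (N u) else 0))"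
  proof (rule computable_publish[OF computable_const, where B = "\<lambda>n. {..n}" and K = 1])
    show "card (N u) \<in> {..n}" if "graph_on n N" for n N u
      using card_nbhd_le[OF that] by simp
  qed auto
  then have "computable (\<lambda>n N. (\<lambda>n (x, d) v. degree_scale (d v)) n (0 :: nat, \<lambda>u. if u < n then card (N u) else 0))"
    by (rule computable_map)
  then have "computable (\<lambda>n N. level N)"
  proof (rule computable_cong)
    fix n N
    assume "graph_on n N"
    then have "N u = {}" if "\<not> u < n" for u
      using that by (auto simp: graph_on_def)
    then show "level N = (\<lambda>n (x, d) v. degree_scale (d v)) n (0 :: nat, \<lambda>u. if u < n then card (N u) else 0)"
      by (auto simp: fun_eq_iff level_def)
  qed
  then have "computable (\<lambda>n N. (level N, {v. v < n \<and> (\<Sum>u\<in>N v. 1 / real (level N u) ^ 17) < real (level N v)}))"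
    by (rule computable_flags)
  then show ?thesis
    by (rule computable_cong) (auto simp: bad_less, auto simp: bad_def)
qed

section \<open>The first stage: sampling for the good vertices\<close>

lemma expectation_add_bernoulli_subset:
  fixes g h :: "nat set \<Rightarrow> real"
  shows "measure_pmf.expectation (bernoulli_subset n p) (\<lambda>S. g S + h S) =
    measure_pmf.expectation (bernoulli_subset n p) g + measure_pmf.expectation (bernoulli_subset n p) h"
  by (intro Bochner_Integration.integral_add integrable_measure_pmf_finite finite_set_bernoulli_subset)

text \<open>A maximal independent set of the sampled vertices is taken, so an unruled vertex has no
  sampled neighbour. For a good vertex of level \<open>b\<close> this has probability at most
  \<open>exp (- b)\<close>, which outweighs its degree of order \<open>b ^ 34\<close>.\<close>

lemma stage_one:
  "\<exists>M C. computable (\<lambda>n N. ((level N, bad N), M n N)) \<and> (\<forall>n N. graph_on n N \<longrightarrow>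
    M n N \<subseteq> {..<n} \<and> independent_in N (M n N) \<and>
    (\<Sum>v\<in>far n N (M n N) - bad N. real (card (N v))) \<le> C * real n)"
proof -
  define p where "p = (\<lambda>b (u :: nat). 1 / real (b u :: nat) ^ 17)"
  have p: "0 \<le> p b u \<and> p b u \<le> 1" for b and u :: nat
    unfolding p_def by (rule inverse_power_unit)
  define D where "D = (\<lambda>n (b, B :: nat set). bernoulli_subset n (p b))"
  \<comment> \<open>Only neighbours of at least the same level are counted. Each sampled edge is
    still counted at one end or both, and the expectation at \<open>v\<close> is at most the degree
    times the square of \<open>p b v\<close>.\<close>
  define f1 where "f1 = (\<lambda>b A (v :: nat) S. if v \<in> S then real (card ({u \<in> A. (b v :: nat) \<le> b u} \<inter> S)) else 0)"
  define f2 where "f2 = (\<lambda>B A (v :: nat) (S :: nat set). if A \<inter> S = {} then (if v \<in> B then 0 else real (card A)) else 0)"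
  define f where "f = (\<lambda>n :: nat. \<lambda>(b, B) A v S. f1 b A v S + f2 B A v S)"
  have "\<exists>S C. computable (\<lambda>n N. ((level N, bad N), S n N)) \<and>
    (\<forall>n N. graph_on n N \<longrightarrow> S n N \<in> set_pmf (D n (level N, bad N)) \<and>
      (\<Sum>v<n. f n (level N, bad N) (N v) v (S n N)) \<le> C * real n)"
  \<comment> \<open>Each of the two costs is at most \<open>n\<close>, whence \<open>b = 2\<close>;
    the summands of \<open>e\<close> bound their expectations at a single vertex.\<close>
  proof (rule computable_derandomize[OF computable_base, where b = 2 and e = "2 ^ 34 + 2 ^ 34 * fact 34"])
    show "finite (set_pmf (D n x))" for n x
      by (cases x) (simp add: D_def finite_set_bernoulli_subset)
  next
    fix n N v S
    assume N: "graph_on n N"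
    have "card ({u \<in> N v. level N v \<le> level N u} \<inter> S) \<le> card (N v)"
      by (intro card_mono graph_on_finite[OF N]) auto
    then have "real (card ({u \<in> N v. level N v \<le> level N u} \<inter> S)) \<le> real n" "real (card (N v)) \<le> real n"
      using card_nbhd_le[OF N, of v] by linarith+
    then have "0 \<le> f1 (level N) (N v) v S \<and> f1 (level N) (N v) v S \<le> real n"
      "0 \<le> f2 (bad N) (N v) v S \<and> f2 (bad N) (N v) v S \<le> real n"
      by (auto simp: f1_def f2_def)
    moreover have "real n + real n \<le> (real n + 1) ^ 2"
      by (simp add: power2_eq_square algebra_simps)
    ultimately show "0 \<le> f n (level N, bad N) (N v) v S \<and> f n (level N, bad N) (N v) v S \<le> (real n + 1) ^ 2"
      unfolding f_def prod.case by linarith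
  next
    fix n N
    assume N: "graph_on n N"
    let ?E = "measure_pmf.expectation (bernoulli_subset n (p (level N)))"
    have "?E (f1 (level N) (N v) v) \<le> 2 ^ 34" if v: "v < n" for v
    proof -
      have "?E (f1 (level N) (N v) v) = p (level N) v * (\<Sum>u\<in>{u \<in> N v. level N v \<le> level N u}. p (level N) u)"
        unfolding f1_def using N v p
        by (intro expectation_edges_bernoulli_subset) (auto simp: graph_on_def)
      also have "\<dots> \<le> p (level N) v * (\<Sum>u\<in>{u \<in> N v. level N v \<le> level N u}. p (level N) v)"
      proof (cases "level N v = 0")
        case False
        then show ?thesis
          using p by (intro mult_left_mono sum_mono) (auto simp: p_def intro!: divide_left_mono power_mono)
      qed (simp add: p_def)
      also have "\<dots> = card {u \<in> N v. level N v \<le> level N u} * (p (level N) v)\<^sup>2"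
        by (simp add: power2_eq_square)
      also have "\<dots> \<le> real (card (N v)) * (p (level N) v)\<^sup>2"
        by (intro mult_right_mono) (auto intro!: card_mono graph_on_finite[OF N])
      also have "\<dots> = real (card (N v)) / real (level N v) ^ 34"
        by (simp add: p_def power_divide flip: power_mult)
      also have "\<dots> \<le> 2 ^ 34"
        using card_le_level[of N v] by (cases "level N v = 0") (auto simp: field_simps)
      finally show ?thesis .
    qed
    moreover have "?E (f2 (bad N) (N v) v) \<le> 2 ^ 34 * fact 34" if v: "v < n" for v
    proof (cases "v \<in> bad N")
      case False
      have "?E (f2 (bad N) (N v) v) \<le> (if v \<in> bad N then 0 else real (card (N v))) * exp (- (\<Sum>u\<in>N v. p (level N) u))"
        unfolding f2_def using N p by (intro expectation_disjoint_bernoulli_subset) (auto simp: graph_on_def)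
      also have "\<dots> \<le> (2 ^ 34 * real (level N v) ^ 34) * exp (- real (level N v))"
        using False card_le_level[of N v] by (intro mult_mono) (auto simp: bad_def p_def)
      also have "\<dots> \<le> (2 ^ 34 * (fact 34 * exp (real (level N v)))) * exp (- real (level N v))"
        by (intro mult_right_mono mult_left_mono power_le_fact_mult_exp) auto
      also have "\<dots> = 2 ^ 34 * fact 34"
        by (simp add: exp_minus)
      finally show ?thesis .
    qed (simp add: f2_def)
    ultimately have "?E (f n (level N, bad N) (N v) v) \<le> 2 ^ 34 + 2 ^ 34 * fact 34" if "v < n" for v
      using that unfolding f_def prod.case expectation_add_bernoulli_subset by (intro add_mono) auto
    then have "(\<Sum>v<n. ?E (f n (level N, bad N) (N v) v)) \<le> (\<Sum>v<n. 2 ^ 34 + 2 ^ 34 * fact 34)"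
      by (intro sum_mono) auto
    then show "(\<Sum>v<n. measure_pmf.expectation (D n (level N, bad N)) (f n (level N, bad N) (N v) v))
        \<le> (2 ^ 34 + 2 ^ 34 * fact 34) * real n"
      by (simp only: D_def prod.case sum_constant card_lessThan mult.commute)
  qed
  then obtain S C where S: "computable (\<lambda>n N. ((level N, bad N), S n N))"
    and S': "\<And>n N. graph_on n N \<Longrightarrow> S n N \<in> set_pmf (D n (level N, bad N))"
    and cost: "\<And>n N. graph_on n N \<Longrightarrow> (\<Sum>v<n. f n (level N, bad N) (N v) v (S n N)) \<le> C * real n"
    by blast
  have S_sub: "S n N \<subseteq> {..<n}" if "graph_on n N" for n N
    using bernoulli_subset_support(1) S'[OF that] by (fastforce simp: D_def)
  have f_nonneg: "0 \<le> f1 b A v T" "0 \<le> f2 B A v T" for b A v T B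
    by (auto simp: f1_def f2_def)
  have cost1: "(\<Sum>v<n. f1 (level N) (N v) v (S n N)) \<le> C * real n"
    and cost2: "(\<Sum>v<n. f2 (bad N) (N v) v (S n N)) \<le> C * real n" if "graph_on n N" for n N
    using cost[OF that] sum_nonneg[of "{..<n}" "\<lambda>v. f1 (level N) (N v) v (S n N)"]
      sum_nonneg[of "{..<n}" "\<lambda>v. f2 (bad N) (N v) v (S n N)"]
    by (simp_all add: f_def sum.distrib f_nonneg)
  have "computable (\<lambda>n N. (((level N, bad N), S n N), {} :: nat set))"
    using computable_map[OF S, of "\<lambda>_ x. (x, {})"] .
  note extend = computable_extend[OF this, where S = "\<lambda>n ((b, B), S) M. S"
      and r = "\<lambda>n ((b, B), S) u v. b u \<le> b v" and C = C, unfolded prod.case]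
  have "\<exists>M. computable (\<lambda>n N. (((level N, bad N), S n N), M n N)) \<and> (\<forall>n N. graph_on n N \<longrightarrow>
    {} \<subseteq> M n N \<and> M n N \<subseteq> {..<n} \<and> independent_in N (M n N) \<and>
    (\<forall>v\<in>far n N (M n N). v \<notin> S n N \<and> N v \<inter> S n N = {}))"
  proof (rule extend)
    fix n N
    assume N: "graph_on n N"
    show "S n N \<subseteq> far n N {}"
      using S_sub[OF N] by (simp add: far_def subset_iff)
  next
    fix n N
    assume N: "graph_on n N"
    have "real (\<Sum>v\<in>S n N. card {u \<in> N v \<inter> S n N. level N v \<le> level N u}) =
      (\<Sum>v\<in>S n N. f1 (level N) (N v) v (S n N))"
      by (auto simp: f1_def Int_def conj_ac intro!: sum.cong)
    also have "\<dots> \<le> (\<Sum>v<n. f1 (level N) (N v) v (S n N))"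
      using S_sub[OF N] by (intro sum_mono2) (auto simp: f_nonneg)
    also have "\<dots> \<le> C * real n"
      by (rule cost1[OF N])
    finally show "real (\<Sum>v\<in>S n N. card {u \<in> N v \<inter> S n N. level N v \<le> level N u}) \<le> C * real n" .
  qed (simp_all add: independent_in_def linear)
  then obtain M where M: "computable (\<lambda>n N. (((level N, bad N), S n N), M n N))"
    and far_M: "\<forall>n N. graph_on n N \<longrightarrow> {} \<subseteq> M n N \<and> M n N \<subseteq> {..<n} \<and> independent_in N (M n N) \<and>
      (\<forall>v\<in>far n N (M n N). v \<notin> S n N \<and> N v \<inter> S n N = {})"
    by (elim exE conjE)
  have M': "M n N \<subseteq> {..<n}" "independent_in N (M n N)" "\<And>v. v \<in> far n N (M n N) \<Longrightarrow> N v \<inter> S n N = {}"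
    if "graph_on n N" for n N
    using far_M that by simp_all
  have "computable (\<lambda>n N. (\<lambda>n ((x, s), m). (x, m)) n (((level N, bad N), S n N), M n N))"
    by (rule computable_map[OF M])
  then have "computable (\<lambda>n N. ((level N, bad N), M n N))"
    by simp
  moreover have "(\<Sum>v\<in>far n N (M n N) - bad N. real (card (N v))) \<le> C * real n" if N: "graph_on n N" for n N
  proof -
    have "(\<Sum>v\<in>far n N (M n N) - bad N. real (card (N v))) = (\<Sum>v\<in>far n N (M n N) - bad N. f2 (bad N) (N v) v (S n N))"
      using M'[OF N] by (intro sum.cong) (auto simp: f2_def)
    also have "\<dots> \<le> (\<Sum>v<n. f2 (bad N) (N v) v (S n N))"
      by (intro sum_mono2) (auto simp: f_nonneg far_def)
    also have "\<dots> \<le> C * real n"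
      by (rule cost2[OF N])
    finally show ?thesis .
  qed
  ultimately show ?thesis
    using M' by blast
qed

section \<open>The third stage: bad vertices of small total weight\<close>

lemma mult_exp_minus_le_1: "x * exp (- x) \<le> (1 :: real)"
proof -
  have "x \<le> exp x"
    using exp_ge_add_one_self[of x] by linarith
  then have "x * exp (- x) \<le> exp x * exp (- x)"
    by (rule mult_right_mono) simp
  then show ?thesis
    by (simp add: exp_minus)
qed

text \<open>Sampling with probability \<open>b ^ (-6)\<close> balances two costs at an unruled bad
  vertex of level \<open>b\<close>, both about its unruled bad neighbours of at most its level: the
  number of sampled edges to them, and their number if none of them is sampled. Either expectation
  is at most \<open>b ^ 6\<close>, and \<open>weight\<close> sums this to
  \<open>O(n)\<close>.\<close>

lemma stage_three:
  assumes M: "computable (\<lambda>n N. ((level N, bad N), M n N))"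
    and M': "\<And>n N. graph_on n N \<Longrightarrow> M n N \<subseteq> {..<n} \<and> independent_in N (M n N)"
    and weight: "\<And>n N. graph_on n N \<Longrightarrow> (\<Sum>v\<in>bad N \<inter> far n N (M n N). real (level N v) ^ 6) \<le> C * real n"
  shows "\<exists>M' C'. computable (\<lambda>n N. ((level N, bad N), M' n N)) \<and> (\<forall>n N. graph_on n N \<longrightarrow>
    M n N \<subseteq> M' n N \<and> M' n N \<subseteq> {..<n} \<and> independent_in N (M' n N) \<and>
    (\<Sum>v\<in>bad N \<inter> far n N (M' n N).
      real (card {u \<in> N v \<inter> (bad N \<inter> far n N (M' n N)). level N u \<le> level N v})) \<le> C' * real n)"
proof -
  define Q where "Q = (\<lambda>n N. bad N \<inter> far n N (M n N))"
  define L where "L = (\<lambda>b Q A v. {u \<in> A \<inter> Q. (b u :: nat) \<le> b (v :: nat)})"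
  have "computable (\<lambda>n N. (\<lambda>n (((b, B), m), F). ((b, m), B \<inter> F)) n (((level N, bad N), M n N), far n N (M n N)))"
    by (rule computable_map[OF computable_far[OF M]])
  then have XQ: "computable (\<lambda>n N. ((level N, M n N), Q n N))"
    by (simp add: Q_def)
  define p where "p = (\<lambda>b Q (u :: nat). if u \<in> Q then 1 / real (b u :: nat) ^ 6 else 0)"
  have p: "0 \<le> p b Q u \<and> p b Q u \<le> 1" for b Q and u :: nat
    unfolding p_def using inverse_power_unit by simp
  define D where "D = (\<lambda>n ((b, m :: nat set), Q). bernoulli_subset n (p b Q))"
  define f1 where "f1 = (\<lambda>b Q A v S. if v \<in> S then real (card (L b Q A v \<inter> S)) else 0)"
  define f2 where "f2 = (\<lambda>b Q A v S. if L b Q A v \<inter> S = {} then (if v \<in> Q then real (card (L b Q A v)) else 0) else 0)"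
  define f where "f = (\<lambda>n :: nat. \<lambda>((b, m :: nat set), Q) A v S. f1 b Q A v S + f2 b Q A v S)"
  have L: "L b Q (N v) v \<subseteq> {..<n}" "v \<notin> L b Q (N v) v" "finite (L b Q (N v) v)" "L b Q (N v) v \<subseteq> N v"
    if "graph_on n N" for n N b Q v
    using that finite_subset[OF _ graph_on_finite[OF that], of "L b Q (N v) v" v]
    by (auto simp: L_def graph_on_def)
  have Q_bad: "v \<in> bad N" "v < n" if "v \<in> Q n N" for v n N
    using that by (auto simp: Q_def far_def)
  have "\<exists>S C. computable (\<lambda>n N. (((level N, M n N), Q n N), S n N)) \<and>
    (\<forall>n N. graph_on n N \<longrightarrow> S n N \<in> set_pmf (D n ((level N, M n N), Q n N)) \<and>
      (\<Sum>v<n. f n ((level N, M n N), Q n N) (N v) v (S n N)) \<le> C * real n)"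
  proof (rule computable_derandomize[OF XQ, where b = 2 and e = "2 * C"])
    show "finite (set_pmf (D n x))" for n x
      by (cases x, cases "fst x") (auto simp add: D_def finite_set_bernoulli_subset)
  next
    fix n N v S
    assume N: "graph_on n N"
    let ?L = "L (level N) (Q n N) (N v) v"
    have "card (?L \<inter> S) \<le> card (N v)" "card ?L \<le> card (N v)"
      using L[OF N] by (blast intro!: card_mono graph_on_finite[OF N])+
    then have "real (card (?L \<inter> S)) \<le> real n" "real (card ?L) \<le> real n"
      using card_nbhd_le[OF N, of v] by linarith+
    then have "0 \<le> f1 (level N) (Q n N) (N v) v S \<and> f1 (level N) (Q n N) (N v) v S \<le> real n"
      "0 \<le> f2 (level N) (Q n N) (N v) v S \<and> f2 (level N) (Q n N) (N v) v S \<le> real n"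
      by (auto simp: f1_def f2_def)
    moreover have "real n + real n \<le> (real n + 1) ^ 2"
      by (simp add: power2_eq_square algebra_simps)
    ultimately show "0 \<le> f n ((level N, M n N), Q n N) (N v) v S \<and> f n ((level N, M n N), Q n N) (N v) v S \<le> (real n + 1) ^ 2"
      unfolding f_def prod.case by linarith
  next
    fix n N
    assume N: "graph_on n N"
    let ?E = "measure_pmf.expectation (bernoulli_subset n (p (level N) (Q n N)))"
    let ?p = "p (level N) (Q n N)"
    let ?f1 = "\<lambda>v. f1 (level N) (Q n N) (N v) v" and ?f2 = "\<lambda>v. f2 (level N) (Q n N) (N v) v"
    let ?L = "\<lambda>v. L (level N) (Q n N) (N v) v"
    have E1: "?E (?f1 v) \<le> (if v \<in> Q n N then real (level N v) ^ 6 else 0)" if v: "v < n" for v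
    proof -
      have eq: "?E (?f1 v) = ?p v * (\<Sum>u\<in>?L v. ?p u)"
        unfolding f1_def using L[OF N] p v by (intro expectation_edges_bernoulli_subset) auto
      show ?thesis
      proof (cases "v \<in> Q n N")
        case True
        let ?b = "real (level N v)"
        have "1 \<le> level N v"
          using Q_bad(1)[OF True] by (rule bad_level_pos)
        then have b: "1 \<le> ?b"
          by simp
        \<comment> \<open>As \<open>level N u\<close> is at most \<open>level N v\<close>, 11 of the
          17 powers in the definition of \<open>bad\<close> are traded for powers of
          \<open>level N v\<close>. The result is \<open>?b ^ (11 + 1 - 6)\<close>.\<close>
        have "(\<Sum>u\<in>?L v. ?p u) \<le> (\<Sum>u\<in>?L v. ?b ^ 11 * (1 / real (level N u) ^ 17))"
        proof (rule sum_mono)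
          fix u
          assume u: "u \<in> ?L v"
          then have "0 < real (level N u)"
            using level_nbr_pos[OF N, of u v] by (simp add: L_def)
          then have "1 / real (level N u) ^ 6 = real (level N u) ^ 11 * (1 / real (level N u) ^ 17)"
            by (simp add: field_simps flip: power_add)
          also have "\<dots> \<le> ?b ^ 11 * (1 / real (level N u) ^ 17)"
            using u by (intro mult_right_mono power_mono) (auto simp: L_def)
          finally show "?p u \<le> ?b ^ 11 * (1 / real (level N u) ^ 17)"
            using u by (simp add: p_def L_def)
        qed
        also have "\<dots> \<le> ?b ^ 11 * (\<Sum>u\<in>N v. 1 / real (level N u) ^ 17)"
          unfolding sum_distrib_left[symmetric] using L[OF N]
          by (intro mult_left_mono sum_mono2 graph_on_finite[OF N]) auto
        also have "\<dots> \<le> ?b ^ 11 * ?b"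
          using Q_bad(1)[OF True] by (intro mult_left_mono) (auto simp: bad_def)
        finally have "?p v * (\<Sum>u\<in>?L v. ?p u) \<le> ?p v * (?b ^ 11 * ?b)"
          using p by (intro mult_left_mono) auto
        also have "\<dots> = ?b ^ 6"
          using b True by (simp add: p_def field_simps power_numeral_reduce)
        finally show ?thesis
          using eq True by simp
      next
        case False
        then have "?p v = 0"
          by (simp add: p_def)
        with eq False show ?thesis
          by simp
      qed
    qed
    have E2: "?E (?f2 v) \<le> (if v \<in> Q n N then real (level N v) ^ 6 else 0)" for v
    proof (cases "v \<in> Q n N")
      case True
      let ?b = "real (level N v)" and ?l = "real (card (?L v))"
      have b: "1 \<le> level N v"
        using Q_bad(1)[OF True] by (rule bad_level_pos)
      have "?E (?f2 v) \<le> (if v \<in> Q n N then ?l else 0) * exp (- (\<Sum>u\<in>?L v. ?p u))"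
        unfolding f2_def using L[OF N] p by (intro expectation_disjoint_bernoulli_subset) auto
      also have "\<dots> = ?l * exp (- (\<Sum>u\<in>?L v. ?p u))"
        using True by simp
      also have "\<dots> \<le> ?l * exp (- (?l / ?b ^ 6))"
      proof -
        have "(\<Sum>u\<in>?L v. 1 / ?b ^ 6) \<le> (\<Sum>u\<in>?L v. ?p u)"
        proof (rule sum_mono)
          fix u
          assume u: "u \<in> ?L v"
          then have "1 \<le> level N u"
            using level_nbr_pos[OF N, of u v] by (simp add: L_def)
          moreover have "real (level N u) ^ 6 \<le> ?b ^ 6"
            using u by (intro power_mono) (auto simp: L_def)
          ultimately show "1 / ?b ^ 6 \<le> ?p u"
            using u by (auto simp: p_def L_def intro!: divide_left_mono)
        qed
        then show ?thesis
          by (intro mult_left_mono) auto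
      qed
      also have "\<dots> = ?b ^ 6 * ((?l / ?b ^ 6) * exp (- (?l / ?b ^ 6)))"
        using b by simp
      also have "\<dots> \<le> ?b ^ 6 * 1"
        by (intro mult_left_mono mult_exp_minus_le_1) simp
      finally show ?thesis
        using True by simp
    qed (simp add: f2_def)
    have "(\<Sum>v<n. ?E (f n ((level N, M n N), Q n N) (N v) v))
      \<le> (\<Sum>v<n. 2 * (if v \<in> Q n N then real (level N v) ^ 6 else 0))"
      unfolding f_def prod.case expectation_add_bernoulli_subset mult_2
      by (intro sum_mono add_mono E1 E2) auto
    also have "\<dots> = 2 * (\<Sum>v<n. if v \<in> Q n N then real (level N v) ^ 6 else 0)"
      by (simp only: sum_distrib_left)
    also have "(\<Sum>v<n. if v \<in> Q n N then real (level N v) ^ 6 else 0) = (\<Sum>v\<in>Q n N. real (level N v) ^ 6)"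
      using Q_bad(2) by (intro sum.mono_neutral_cong_right) auto
    also have "\<dots> \<le> C * real n"
      using weight[OF N] by (simp add: Q_def)
    finally show "(\<Sum>v<n. measure_pmf.expectation (D n ((level N, M n N), Q n N)) (f n ((level N, M n N), Q n N) (N v) v))
        \<le> 2 * C * real n"
      unfolding D_def prod.case by linarith
  qed
  then obtain S C' where S: "computable (\<lambda>n N. (((level N, M n N), Q n N), S n N))"
    and S_all: "\<forall>n N. graph_on n N \<longrightarrow> S n N \<in> set_pmf (D n ((level N, M n N), Q n N)) \<and>
      (\<Sum>v<n. f n ((level N, M n N), Q n N) (N v) v (S n N)) \<le> C' * real n"
    by (elim exE conjE)
  have S_sub: "S n N \<subseteq> Q n N" if "graph_on n N" for n N
  proof
    fix u
    assume u: "u \<in> S n N"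
    have "S n N \<in> set_pmf (bernoulli_subset n (p (level N) (Q n N)))"
      using S_all that by (simp add: D_def)
    from bernoulli_subset_support(2)[OF this u] show "u \<in> Q n N"
      by (simp add: p_def split: if_splits)
  qed
  have f_nonneg: "0 \<le> f1 b B A v T" "0 \<le> f2 b B A v T" for b A v T B
    by (auto simp: f1_def f2_def)
  have cost1: "(\<Sum>v<n. f1 (level N) (Q n N) (N v) v (S n N)) \<le> C' * real n"
    and cost2: "(\<Sum>v<n. f2 (level N) (Q n N) (N v) v (S n N)) \<le> C' * real n" if "graph_on n N" for n N
  proof -
    have "(\<Sum>v<n. f n ((level N, M n N), Q n N) (N v) v (S n N)) \<le> C' * real n"
      using S_all that by blast
    then show "(\<Sum>v<n. f1 (level N) (Q n N) (N v) v (S n N)) \<le> C' * real n"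
      "(\<Sum>v<n. f2 (level N) (Q n N) (N v) v (S n N)) \<le> C' * real n"
      using sum_nonneg[of "{..<n}" "\<lambda>v. f1 (level N) (Q n N) (N v) v (S n N)"]
        sum_nonneg[of "{..<n}" "\<lambda>v. f2 (level N) (Q n N) (N v) v (S n N)"]
      by (simp_all add: f_def sum.distrib f_nonneg)
  qed
  have "computable (\<lambda>n N. ((((level N, M n N), Q n N), S n N), bad N))"
  proof -
    have "computable (\<lambda>n N. ((((level N, M n N), Q n N), S n N),
        {v. v < n \<and> (\<Sum>u\<in>N v. 1 / real (level N u) ^ 17) < real (level N v)}))"
      using computable_flags[OF S, of "\<lambda>n (((b, m), q), s) A v. (\<Sum>u\<in>A. 1 / real (b u) ^ 17) < real (b v)"]
      by (simp only: prod.case)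
    then show ?thesis
      by (rule computable_cong) (auto simp: bad_less, auto simp: bad_def)
  qed
  then have "computable (\<lambda>n N. (\<lambda>n ((((b, m), q), s), B). (((b, B), s), m)) n ((((level N, M n N), Q n N), S n N), bad N))"
    by (rule computable_map)
  then have "computable (\<lambda>n N. (((level N, bad N), S n N), M n N))"
    by (simp only: prod.case)
  note extend = computable_extend[OF this, where S = "\<lambda>n ((b, B), S) M. S"
      and r = "\<lambda>n ((b, B), S) v u. b u \<le> b v" and C = C', unfolded prod.case]
  have "\<exists>M'. computable (\<lambda>n N. (((level N, bad N), S n N), M' n N)) \<and> (\<forall>n N. graph_on n N \<longrightarrow>
    M n N \<subseteq> M' n N \<and> M' n N \<subseteq> {..<n} \<and> independent_in N (M' n N) \<and>
    (\<forall>v\<in>far n N (M' n N). v \<notin> S n N \<and> N v \<inter> S n N = {}))"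
  proof (rule extend)
    fix n N
    assume N: "graph_on n N"
    show "S n N \<subseteq> far n N (M n N)"
      using S_sub[OF N] by (auto simp: Q_def)
    show "M n N \<subseteq> {..<n} \<and> independent_in N (M n N)"
      by (rule M'[OF N])
    have "real (\<Sum>v\<in>S n N. card {u \<in> N v \<inter> S n N. level N u \<le> level N v}) =
      (\<Sum>v\<in>S n N. f1 (level N) (Q n N) (N v) v (S n N))"
    proof -
      have "{u \<in> N v \<inter> S n N. level N u \<le> level N v} = L (level N) (Q n N) (N v) v \<inter> S n N" for v
        using S_sub[OF N] by (auto simp: L_def)
      then show ?thesis
        by (simp add: f1_def)
    qed
    also have "\<dots> \<le> (\<Sum>v<n. f1 (level N) (Q n N) (N v) v (S n N))"
      using S_sub[OF N] Q_bad(2) by (intro sum_mono2) (auto simp: f_nonneg)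
    also have "\<dots> \<le> C' * real n"
      by (rule cost1[OF N])
    finally show "real (\<Sum>v\<in>S n N. card {u \<in> N v \<inter> S n N. level N u \<le> level N v}) \<le> C' * real n" .
  qed (simp_all add: linear)
  then obtain M' where M': "computable (\<lambda>n N. (((level N, bad N), S n N), M' n N))"
    and far_M': "\<forall>n N. graph_on n N \<longrightarrow> M n N \<subseteq> M' n N \<and> M' n N \<subseteq> {..<n} \<and> independent_in N (M' n N) \<and>
      (\<forall>v\<in>far n N (M' n N). v \<notin> S n N \<and> N v \<inter> S n N = {})"
    by (elim exE conjE)
  have "computable (\<lambda>n N. (\<lambda>n ((x, s), m). (x, m)) n (((level N, bad N), S n N), M' n N))"
    by (rule computable_map[OF M'])
  then have "computable (\<lambda>n N. ((level N, bad N), M' n N))"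
    by simp
  moreover have "(\<Sum>v\<in>bad N \<inter> far n N (M' n N).
      real (card {u \<in> N v \<inter> (bad N \<inter> far n N (M' n N)). level N u \<le> level N v})) \<le> C' * real n"
    if N: "graph_on n N" for n N
  proof -
    let ?R = "bad N \<inter> far n N (M' n N)"
    have props: "M n N \<subseteq> M' n N" "\<And>v. v \<in> far n N (M' n N) \<Longrightarrow> N v \<inter> S n N = {}"
      using far_M' N by simp_all
    have R: "?R \<subseteq> Q n N"
      unfolding Q_def using far_antimono[OF props(1)] by blast
    have "(\<Sum>v\<in>?R. real (card {u \<in> N v \<inter> ?R. level N u \<le> level N v}))
      \<le> (\<Sum>v\<in>?R. f2 (level N) (Q n N) (N v) v (S n N))"
    proof (rule sum_mono)
      fix v
      assume v: "v \<in> ?R"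
      then have "L (level N) (Q n N) (N v) v \<inter> S n N = {}"
        using props(2)[of v] by (auto simp: L_def)
      moreover have "card {u \<in> N v \<inter> ?R. level N u \<le> level N v} \<le> card (L (level N) (Q n N) (N v) v)"
        using R L(3)[OF N] by (intro card_mono) (auto simp: L_def)
      ultimately show "real (card {u \<in> N v \<inter> ?R. level N u \<le> level N v}) \<le> f2 (level N) (Q n N) (N v) v (S n N)"
        using v R by (auto simp: f2_def)
    qed
    also have "\<dots> \<le> (\<Sum>v<n. f2 (level N) (Q n N) (N v) v (S n N))"
      by (intro sum_mono2) (auto simp: f_nonneg far_def)
    also have "\<dots> \<le> C' * real n"
      by (rule cost2[OF N])
    finally show ?thesis .
  qed
  ultimately show ?thesis
    using far_M' by (intro exI[of _ M'] exI[of _ C']) simp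
qed

text \<open>An edge with a good end is reported by that end, an edge between bad vertices by an end
  whose level is not the lower one; so \<open>C1 + C2\<close> bounds the reports. A maximal
  independent set of all unruled vertices leaves none unruled.\<close>

lemma stage_four:
  assumes M: "computable (\<lambda>n N. ((level N, bad N), M n N))"
    and M': "\<And>n N. graph_on n N \<Longrightarrow> M n N \<subseteq> {..<n} \<and> independent_in N (M n N)"
    and good: "\<And>n N. graph_on n N \<Longrightarrow> (\<Sum>v\<in>far n N (M n N) - bad N. real (card (N v))) \<le> C1 * real n"
    and bad: "\<And>n N. graph_on n N \<Longrightarrow> (\<Sum>v\<in>bad N \<inter> far n N (M n N).
      real (card {u \<in> N v \<inter> (bad N \<inter> far n N (M n N)). level N u \<le> level N v})) \<le> C2 * real n"
  shows "\<exists>M'. computable (\<lambda>n N. M' n N) \<and> (\<forall>n N. graph_on n N \<longrightarrow>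
    M' n N \<subseteq> {..<n} \<and> independent_in N (M' n N) \<and> far n N (M' n N) = {})"
proof -
  have "computable (\<lambda>n N. (\<lambda>n (((b, B), m), F). (((b, B), F), m)) n (((level N, bad N), M n N), far n N (M n N)))"
    by (rule computable_map[OF computable_far[OF M]])
  then have "computable (\<lambda>n N. (((level N, bad N), far n N (M n N)), M n N))"
    by simp
  note extend = computable_extend[OF this, where S = "\<lambda>n ((b, B), F) M. F"
      and r = "\<lambda>n ((b, B), F) v u. v \<notin> B \<or> u \<in> B \<and> b u \<le> b v" and C = "C1 + C2", unfolded prod.case]
  have "\<exists>M'. computable (\<lambda>n N. (((level N, bad N), far n N (M n N)), M' n N)) \<and> (\<forall>n N. graph_on n N \<longrightarrow>
    M n N \<subseteq> M' n N \<and> M' n N \<subseteq> {..<n} \<and> independent_in N (M' n N) \<and>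
    (\<forall>v\<in>far n N (M' n N). v \<notin> far n N (M n N) \<and> N v \<inter> far n N (M n N) = {}))"
  proof (rule extend)
    fix n N
    assume N: "graph_on n N"
    show "M n N \<subseteq> {..<n} \<and> independent_in N (M n N)"
      by (rule M'[OF N])
    let ?F = "far n N (M n N)"
    let ?e = "\<lambda>v. real (card {u \<in> N v \<inter> ?F. v \<notin> bad N \<or> u \<in> bad N \<and> level N u \<le> level N v})"
    have "real (\<Sum>v\<in>?F. card {u \<in> N v \<inter> ?F. v \<notin> bad N \<or> u \<in> bad N \<and> level N u \<le> level N v}) =
      sum ?e ((?F - bad N) \<union> (bad N \<inter> ?F))"
      unfolding of_nat_sum by (rule sum.cong) auto
    also have "\<dots> = sum ?e (?F - bad N) + sum ?e (bad N \<inter> ?F)"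
      by (rule sum.union_disjoint) (auto simp: finite_far)
    also have "\<dots> \<le> (\<Sum>v\<in>?F - bad N. real (card (N v))) + (\<Sum>v\<in>bad N \<inter> ?F.
      real (card {u \<in> N v \<inter> (bad N \<inter> ?F). level N u \<le> level N v}))"
    proof (intro add_mono sum_mono of_nat_mono card_mono)
      show "{u \<in> N v \<inter> ?F. v \<notin> bad N \<or> u \<in> bad N \<and> level N u \<le> level N v}
        \<subseteq> {u \<in> N v \<inter> (bad N \<inter> ?F). level N u \<le> level N v}" if "v \<in> bad N \<inter> ?F" for v
        using that by auto
    qed (auto simp: graph_on_finite[OF N])
    also have "\<dots> \<le> (C1 + C2) * real n"
      using good[OF N] bad[OF N] by (simp add: distrib_right)
    finally show "real (\<Sum>v\<in>?F. card {u \<in> N v \<inter> ?F. v \<notin> bad N \<or> u \<in> bad N \<and> level N u \<le> level N v})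
      \<le> (C1 + C2) * real n" .
  qed auto
  then obtain M' where M': "computable (\<lambda>n N. (((level N, bad N), far n N (M n N)), M' n N))"
    and far_M': "\<forall>n N. graph_on n N \<longrightarrow> M n N \<subseteq> M' n N \<and> M' n N \<subseteq> {..<n} \<and> independent_in N (M' n N) \<and>
      (\<forall>v\<in>far n N (M' n N). v \<notin> far n N (M n N) \<and> N v \<inter> far n N (M n N) = {})"
    by (elim exE conjE)
  have "computable (\<lambda>n N. (\<lambda>n (x, m). m) n (((level N, bad N), far n N (M n N)), M' n N))"
    by (rule computable_map[OF M'])
  then have "computable (\<lambda>n N. M' n N)"
    by simp
  moreover have "far n N (M' n N) = {}" if "graph_on n N" for n N
    using far_M' that far_antimono[of "M n N" "M' n N" n N] by blast
  ultimately show ?thesis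
    using far_M' by (intro exI[of _ M']) simp
qed

section \<open>The second stage: direct choice of sampled bad vertices\<close>

definition class_nbrs :: "(nat \<Rightarrow> nat) \<Rightarrow> nat set \<Rightarrow> nat set \<Rightarrow> nat \<Rightarrow> nat set" where
  "class_nbrs b Q A k = {x \<in> A \<inter> Q. b x = k}"

text \<open>If the class is large enough, sampling with probability \<open>k ^ (-25)\<close> hits
  \<open>k\<close> of these \<open>k ^ 26\<close> vertices on average. The selection depends on
  public data and the neighbourhood alone and is therefore fixed before the sample.\<close>

definition sample_nbrs :: "(nat \<Rightarrow> nat) \<Rightarrow> nat set \<Rightarrow> nat set \<Rightarrow> nat \<Rightarrow> nat set" where
  "sample_nbrs b Q A k =
     (if k ^ 26 \<le> card (class_nbrs b Q A k)
      then SOME T. T \<subseteq> class_nbrs b Q A k \<and> card T = k ^ 26 else {})"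

lemma sample_nbrs_subset: "sample_nbrs b Q A k \<subseteq> class_nbrs b Q A k"
  and card_sample_nbrs: "k ^ 26 \<le> card (class_nbrs b Q A k) \<Longrightarrow> card (sample_nbrs b Q A k) = k ^ 26"
proof -
  have *: "sample_nbrs b Q A k \<subseteq> class_nbrs b Q A k \<and> card (sample_nbrs b Q A k) = k ^ 26"
    if heavy: "k ^ 26 \<le> card (class_nbrs b Q A k)"
  proof -
    obtain T where "T \<subseteq> class_nbrs b Q A k" "card T = k ^ 26"
      using obtain_subset_with_card_n[OF heavy] by blast
    then have "\<exists>T. T \<subseteq> class_nbrs b Q A k \<and> card T = k ^ 26"
      by blast
    from someI_ex[OF this] heavy show ?thesis
      by (simp add: sample_nbrs_def)
  qed
  then show "sample_nbrs b Q A k \<subseteq> class_nbrs b Q A k"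
    by (cases "k ^ 26 \<le> card (class_nbrs b Q A k)") (auto simp: sample_nbrs_def)
  show "k ^ 26 \<le> card (class_nbrs b Q A k) \<Longrightarrow> card (sample_nbrs b Q A k) = k ^ 26"
    using * by blast
qed

lemma sum_nbrs_swap:
  fixes g :: "nat \<Rightarrow> real"
  assumes "graph_on n N" "Q \<subseteq> {..<n}"
  shows "(\<Sum>w<n. \<Sum>x\<in>N w \<inter> Q. g x) = (\<Sum>x\<in>Q. real (card (N x)) * g x)"
proof -
  have "(\<Sum>w<n. \<Sum>x\<in>N w \<inter> Q. g x) = (\<Sum>w<n. \<Sum>x | x \<in> Q \<and> x \<in> N w. g x)"
    by (intro sum.cong) auto
  also have "\<dots> = (\<Sum>x\<in>Q. \<Sum>w | w \<in> {..<n} \<and> x \<in> N w. g x)"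
    using assms(2) by (intro sum.swap_restrict) (auto intro: finite_subset)
  also have "\<dots> = (\<Sum>x\<in>Q. \<Sum>w\<in>N x. g x)"
    using assms(1) by (intro sum.cong) (auto simp: graph_on_def)
  finally show ?thesis
    by simp
qed

text \<open>Members of \<open>N w\<close> have levels from 1 to \<open>n\<close>, so the classes
  partition \<open>N w \<inter> Q\<close>.\<close>

lemma sum_class_nbrs:
  fixes g :: "nat \<Rightarrow> real"
  assumes N: "graph_on n N"
  shows "(\<Sum>k=1..n. real (card (class_nbrs (level N) Q (N w) k)) * g k) = (\<Sum>x\<in>N w \<inter> Q. g (level N x))"
proof -
  have "(\<Sum>k=1..n. \<Sum>x | x \<in> N w \<inter> Q \<and> level N x = k. g (level N x)) = (\<Sum>x\<in>N w \<inter> Q. g (level N x))"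
    using level_nbr_pos[OF N] level_le[OF N]
    by (intro sum.group) (auto simp: graph_on_finite[OF N])
  then show ?thesis
    by (simp add: class_nbrs_def)
qed

text \<open>Telescoping, with \<open>1 / (n + 1) ^ 2\<close> at most
  \<open>1 / n - 1 / (n + 1)\<close>.\<close>

lemma sum_inverse_squares_le: "(\<Sum>k=1..n. 1 / real k ^ 2) \<le> 2"
proof -
  have "(\<Sum>k=1..n. 1 / real k ^ 2) \<le> 2 - 1 / real n" if "1 \<le> n"
    using that
  proof (induction n rule: dec_induct)
    case (step n)
    have "1 / real (Suc n) ^ 2 \<le> 1 / (real n * real (Suc n))"
      using step.hyps by (intro divide_left_mono) (auto simp: power2_eq_square)
    also have "\<dots> = 1 / real n - 1 / real (Suc n)"
      using step.hyps by (simp add: field_simps)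
    finally show ?case
      using step.IH by simp
  qed simp
  moreover have "0 \<le> 1 / real n"
    by simp
  ultimately show ?thesis
    by (cases n) (simp, linarith)
qed

text \<open>
  Let \<open>w\<close> be a vertex with at least \<open>k ^ 26\<close> neighbours of level \<open>k\<close> in \<open>Q\<close>. Among \<open>k ^ 26\<close> of
  them, fixed in advance, none is sampled with probability at most \<open>exp (- k)\<close>, and one is sampled
  and killed with probability at most \<open>k ^ (-6)\<close>. Otherwise \<open>w\<close> is dominated. Being killed depends
  on the neighbourhood of the sampled vertex, so this vertex is charged for \<open>w\<close>; it learns the
  amount from the numbers that are exchanged first.
\<close>

lemma stage_two:
  assumes M: "computable (\<lambda>n N. ((level N, bad N), M n N))"
    and M': "\<And>n N. graph_on n N \<Longrightarrow> M n N \<subseteq> {..<n} \<and> independent_in N (M n N)"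
  shows "\<exists>M' C. computable (\<lambda>n N. ((level N, bad N), M' n N)) \<and> (\<forall>n N. graph_on n N \<longrightarrow>
    M n N \<subseteq> M' n N \<and> M' n N \<subseteq> {..<n} \<and> independent_in N (M' n N) \<and>
    (\<Sum>v\<in>bad N \<inter> far n N (M' n N). real (level N v) ^ 6) \<le> C * real n)"
proof -
  define Q where "Q = (\<lambda>n N. bad N \<inter> far n N (M n N))"
  have Q_bad: "v \<in> bad N" "v < n" if "v \<in> Q n N" for v n N
    using that by (auto simp: Q_def far_def)
  have Q_sub: "Q n N \<subseteq> {..<n}" for n N
    using Q_bad by auto
  have "computable (\<lambda>n N. (\<lambda>n (((b, B), m), F). (((b, B), m), B \<inter> F)) n (((level N, bad N), M n N), far n N (M n N)))"
    by (rule computable_map[OF computable_far[OF M]])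
  then have XQ: "computable (\<lambda>n N. (((level N, bad N), M n N), Q n N))"
    by (simp add: Q_def)
  let ?K = "\<lambda>n N w k. class_nbrs (level N) (Q n N) (N w) k"
  let ?T = "\<lambda>n N w k. sample_nbrs (level N) (Q n N) (N w) k"
  have K: "finite (?K n N w k)" "card (?K n N w k) \<le> n" if N: "graph_on n N" for n N w k
  proof -
    show "finite (?K n N w k)"
      using graph_on_finite[OF N] by (simp add: class_nbrs_def)
    have "card (?K n N w k) \<le> card (N w)"
      using graph_on_finite[OF N] by (intro card_mono) (auto simp: class_nbrs_def)
    then show "card (?K n N w k) \<le> n"
      using card_nbhd_le[OF N, of w] by linarith
  qed
  \<comment> \<open>A vertex \<open>v\<close> tells each member \<open>u\<close> of its fixed
    selections the size of the class that is at stake if \<open>u\<close> is killed;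
    \<open>c\<close> is the total that \<open>u\<close> is told.\<close>
  define s where "s = (\<lambda>n :: nat. \<lambda>(((b, B :: nat set), m :: nat set), Q) A (v :: nat) u.
    if u \<in> sample_nbrs b Q A (b u) then card (class_nbrs b Q A (b u)) else 0)"
  define c where "c = (\<lambda>n N u. if u < n then \<Sum>v<n. s n (((level N, bad N), M n N), Q n N) (N v) v u else 0)"
  have X: "computable (\<lambda>n N. ((((level N, bad N), M n N), Q n N), c n N))"
    unfolding c_def
  proof (rule computable_exchange_numbers[OF XQ, where K = 1])
    fix n N u v
    assume "graph_on n N" "u < n" "v < n"
    then show "s n (((level N, bad N), M n N), Q n N) (N v) v u < (n + 1) ^ 1"
      using K[of n N v "level N u"] by (simp add: s_def)
  qed
  \<comment> \<open>Charges collected at \<open>x\<close> are rearranged by the vertex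
    \<open>w\<close> that sent them and the level \<open>k\<close> of \<open>x\<close>.\<close>
  have sum_c: "(\<Sum>x<n. g x * real (c n N x)) =
      (\<Sum>w<n. \<Sum>k=1..n. \<Sum>x\<in>?T n N w k. g x * real (card (?K n N w k)))"
    if N: "graph_on n N" for n N and g :: "nat \<Rightarrow> real"
  proof -
    have "(\<Sum>x<n. g x * real (c n N x)) = (\<Sum>x<n. \<Sum>w<n.
        if x \<in> ?T n N w (level N x) then g x * real (card (?K n N w (level N x))) else 0)"
      by (auto simp: c_def s_def sum_distrib_left intro!: sum.cong)
    also have "\<dots> = (\<Sum>w<n. \<Sum>x<n.
        if x \<in> ?T n N w (level N x) then g x * real (card (?K n N w (level N x))) else 0)"
      by (rule sum.swap)
    also have "\<dots> = (\<Sum>w<n. \<Sum>k=1..n. \<Sum>x\<in>?T n N w k. g x * real (card (?K n N w k)))"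
    proof (rule sum.cong)
      fix w
      let ?S = "{x. x < n \<and> x \<in> ?T n N w (level N x)}"
      have T: "x < n \<and> level N x = k \<and> k \<in> {1..n}" if "x \<in> ?T n N w k" for x k
        using that sample_nbrs_subset[of "level N" "Q n N" "N w" k] level_nbr_pos[OF N, of x w]
          level_le[OF N, of x] Q_bad(2)[of x n N] by (auto simp: class_nbrs_def)
      have "(\<Sum>x<n. if x \<in> ?T n N w (level N x) then g x * real (card (?K n N w (level N x))) else 0) =
        (\<Sum>x\<in>?S. g x * real (card (?K n N w (level N x))))"
        by (intro sum.mono_neutral_cong_right) auto
      also have "\<dots> = (\<Sum>k=1..n. \<Sum>x | x \<in> ?S \<and> level N x = k. g x * real (card (?K n N w (level N x))))"
      proof (rule sum.group[symmetric])
        show "level N ` ?S \<subseteq> {1..n}"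
          using T by blast
      qed simp_all
      also have "\<dots> = (\<Sum>k=1..n. \<Sum>x\<in>?T n N w k. g x * real (card (?K n N w k)))"
      proof (rule sum.cong)
        fix k
        have "{x. x \<in> ?S \<and> level N x = k} = ?T n N w k"
          using T by blast
        moreover have "level N x = k" if "x \<in> ?T n N w k" for x
          using T[OF that] by blast
        ultimately show "(\<Sum>x | x \<in> ?S \<and> level N x = k. g x * real (card (?K n N w (level N x)))) =
          (\<Sum>x\<in>?T n N w k. g x * real (card (?K n N w k)))"
          by (intro sum.cong) simp_all
      qed simp
      finally show "(\<Sum>x<n. if x \<in> ?T n N w (level N x) then g x * real (card (?K n N w (level N x))) else 0) =
        (\<Sum>k=1..n. \<Sum>x\<in>?T n N w k. g x * real (card (?K n N w k)))" .
    qed simp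
    finally show ?thesis .
  qed

  \<comment> \<open>Sampling and the costs of an outcome\<close>
  define p where "p = (\<lambda>b Q (u :: nat). if u \<in> Q then 1 / real (b u :: nat) ^ 25 else 0)"
  have p: "0 \<le> p b Q u \<and> p b Q u \<le> 1" for b Q and u :: nat
    unfolding p_def using inverse_power_unit by simp
  define D where "D = (\<lambda>n ((((b, B :: nat set), m :: nat set), Q), c :: nat \<Rightarrow> nat). bernoulli_subset n (p b Q))"
  \<comment> \<open>The exponent 28 is 34 - 6: the weight \<open>b ^ 6\<close> of a vertex of level
    \<open>b\<close> is at most its degree times \<open>b ^ (-28)\<close>, an amount that is
    distributed over its neighbours.\<close>
  define f0 where "f0 = (\<lambda>b Q A (k :: nat) Y. if sample_nbrs b Q A k \<inter> Y = {}
    then (if k ^ 26 \<le> card (class_nbrs b Q A k) then real (card (class_nbrs b Q A k)) / real k ^ 28 else 0) else 0)"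
  define f1 where "f1 = (\<lambda>n b Q A Y. \<Sum>k=1..n. f0 b Q A k Y)"
  \<comment> \<open>Of two adjacent sampled vertices in \<open>Q\<close> the one of lower level is
    killed, and both are if the levels agree; hence the survivors are independent.\<close>
  define killed where "killed = (\<lambda>b Q A v Y. v \<in> Y \<and> (\<exists>y\<in>A \<inter> Q \<inter> Y. (b v :: nat) \<le> b (y :: nat)))"
  define f2 where "f2 = (\<lambda>b Q (c :: nat \<Rightarrow> nat) A v Y.
    if killed b Q A v Y then 1 / real (b v) ^ 28 * real (c v) else 0)"
  define f where "f = (\<lambda>n :: nat. \<lambda>((((b, B :: nat set), m :: nat set), Q), c) A v Y. f1 n b Q A Y + f2 b Q c A v Y)"
  let ?x = "\<lambda>n N. ((((level N, bad N), M n N), Q n N), c n N)"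
  have f0_nonneg: "0 \<le> f0 b Q A k Y" for b Q A k Y
    by (simp add: f0_def)
  have f1_nonneg: "0 \<le> f1 n b Q A Y" for n b Q A Y
    unfolding f1_def by (intro sum_nonneg f0_nonneg)
  have f2_nonneg: "0 \<le> f2 b Q c A v Y" for b Q c A v Y
    by (simp add: f2_def)
  have "\<exists>Y C. computable (\<lambda>n N. (?x n N, Y n N)) \<and>
    (\<forall>n N. graph_on n N \<longrightarrow> Y n N \<in> set_pmf (D n (?x n N)) \<and>
      (\<Sum>v<n. f n (?x n N) (N v) v (Y n N)) \<le> C * real n)"
  \<comment> \<open>The factor 721 is \<open>fact 6\<close> for the selections without a sampled
    member plus 1 for the killed vertices; \<open>2 ^ 34\<close> is the loss from rounding in the
    levels.\<close>
  proof (rule computable_derandomize[OF X, where b = 3 and e = "721 * 2 ^ 34"])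
    show "finite (set_pmf (D n x))" for n x
      by (auto simp: D_def finite_set_bernoulli_subset split: prod.split)
  next
    fix n N v Y
    assume N: "graph_on n N"
    have "f0 (level N) (Q n N) (N v) k Y \<le> real n" for k
    proof -
      have "real (card (?K n N v k)) * (1 / real k ^ 28) \<le> real n * 1"
        using K(2)[OF N] inverse_power_unit by (intro mult_mono) auto
      then show ?thesis
        by (auto simp: f0_def)
    qed
    then have "f1 n (level N) (Q n N) (N v) Y \<le> (\<Sum>k=1..n. real n)"
      unfolding f1_def by (intro sum_mono) auto
    moreover have "(\<Sum>w<n. s n (((level N, bad N), M n N), Q n N) (N w) w v) \<le> (\<Sum>w<n. n)"
      by (intro sum_mono) (use K(2)[OF N] in \<open>simp add: s_def\<close>)
    then have "c n N v \<le> n * n"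
      by (simp add: c_def)
    then have "1 / real (level N v) ^ 28 * real (c n N v) \<le> 1 * real (n * n)"
      using inverse_power_unit by (intro mult_mono of_nat_mono) auto
    then have "f2 (level N) (Q n N) (c n N) (N v) v Y \<le> real n * real n"
      by (simp add: f2_def)
    moreover have "real n * real n + real n * real n \<le> (real n + 1) ^ 3"
      by (simp add: power3_eq_cube algebra_simps)
    ultimately show "0 \<le> f n (?x n N) (N v) v Y \<and> f n (?x n N) (N v) v Y \<le> (real n + 1) ^ 3"
      using f1_nonneg f2_nonneg by (simp add: f_def)
  next

    \<comment> \<open>The expected cost\<close>
    fix n N
    assume N: "graph_on n N"
    let ?E = "measure_pmf.expectation (bernoulli_subset n (p (level N) (Q n N)))"
    let ?p = "p (level N) (Q n N)"
    \<comment> \<open>Both kinds of cost are bounded by a multiple of this sum. Double counting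
      turns it into a sum over \<open>Q\<close> of the degrees divided by 34th powers of the levels,
      which is \<open>O(n)\<close>.\<close>
    let ?\<Psi> = "\<Sum>w<n. \<Sum>k=1..n. real (card (?K n N w k)) * (1 / real k ^ 34)"
    have T: "?T n N v k \<subseteq> {..<n}" "finite (?T n N v k)" for v k
    proof -
      show sub: "?T n N v k \<subseteq> {..<n}"
        using sample_nbrs_subset[of "level N" "Q n N" "N v" k] N by (auto simp: class_nbrs_def graph_on_def)
      show "finite (?T n N v k)"
        using sub by (rule finite_subset) simp
    qed
    have E0: "?E (f0 (level N) (Q n N) (N v) k) \<le> 720 * (real (card (?K n N v k)) * (1 / real k ^ 34))"
      if k: "1 \<le> k" for v k
    proof (cases "k ^ 26 \<le> card (?K n N v k)")
      case True
      have "(\<Sum>u\<in>?T n N v k. ?p u) = (\<Sum>u\<in>?T n N v k. 1 / real k ^ 25)"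
        using sample_nbrs_subset[of "level N" "Q n N" "N v" k]
        by (intro sum.cong) (auto simp: p_def class_nbrs_def)
      also have "\<dots> = real k"
        using k by (simp add: card_sample_nbrs[OF True] power_numeral_reduce)
      finally have sum_p: "(\<Sum>u\<in>?T n N v k. ?p u) = real k" .
      have "?E (f0 (level N) (Q n N) (N v) k) \<le> (if k ^ 26 \<le> card (?K n N v k)
          then real (card (?K n N v k)) / real k ^ 28 else 0) * exp (- (\<Sum>u\<in>?T n N v k. ?p u))"
        unfolding f0_def using T p by (intro expectation_disjoint_bernoulli_subset) auto
      also have "\<dots> = real (card (?K n N v k)) / real k ^ 28 * exp (- real k)"
        using True by (simp add: sum_p)
      also have "\<dots> \<le> real (card (?K n N v k)) / real k ^ 28 * (720 / real k ^ 6)"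
      proof (rule mult_left_mono)
        \<comment> \<open>Six powers lift the exponent 28 to the 34 of
          \<open>?\<Psi>\<close>.\<close>
        have "real k ^ 6 \<le> 720 * exp (real k)"
          using power_le_fact_mult_exp[of "real k" 6] by (simp add: fact_numeral)
        then show "exp (- real k) \<le> 720 / real k ^ 6"
          using k by (simp add: exp_minus field_simps)
      qed simp
      also have "\<dots> = 720 * (real (card (?K n N v k)) * (1 / real k ^ 34))"
        by (simp flip: power_add)
      finally show ?thesis .
    next
      case False
      then show ?thesis
        by (simp add: f0_def)
    qed
    have E1: "?E (f1 n (level N) (Q n N) (N v)) \<le> 720 * (\<Sum>k=1..n. real (card (?K n N v k)) * (1 / real k ^ 34))" for v
    proof -
      have "?E (f1 n (level N) (Q n N) (N v)) = (\<Sum>k=1..n. ?E (f0 (level N) (Q n N) (N v) k))"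
        unfolding f1_def
        by (intro Bochner_Integration.integral_sum integrable_measure_pmf_finite finite_set_bernoulli_subset)
      also have "\<dots> \<le> (\<Sum>k=1..n. 720 * (real (card (?K n N v k)) * (1 / real k ^ 34)))"
        by (intro sum_mono E0) auto
      finally show ?thesis
        by (simp only: sum_distrib_left)
    qed
    \<comment> \<open>The probability that a vertex of level \<open>b\<close> is killed is at most
      the expected number of its sampled edges to vertices of at least its level. This is at most
      \<open>b ^ (-32)\<close>: a factor \<open>b ^ (-25)\<close> for the vertex itself, and
      \<open>b ^ (-8) * b\<close> for the neighbours because it is bad. The weight
      \<open>b ^ (-28)\<close> completes the exponent 60.\<close>
    have E2: "?E (f2 (level N) (Q n N) (c n N) (N v) v) \<le> 1 / real (level N v) ^ 60 * real (c n N v)"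
      if v: "v < n" for v
    proof -
      let ?b = "real (level N v)" and ?L = "{y \<in> N v \<inter> Q n N. level N v \<le> level N y}"
      let ?h = "\<lambda>Y. if v \<in> Y then real (card (?L \<inter> Y)) else 0"
      have finL: "finite ?L"
        using graph_on_finite[OF N] by simp
      have L: "?L \<subseteq> {..<n}" "v \<notin> ?L"
        using N by (auto simp: graph_on_def)
      have f2_le: "f2 (level N) (Q n N) (c n N) (N v) v Y \<le> ?h Y * (1 / ?b ^ 28 * real (c n N v))" for Y
      proof (cases "killed (level N) (Q n N) (N v) v Y")
        case True
        then have "?L \<inter> Y \<noteq> {}" "v \<in> Y"
          by (auto simp: killed_def)
        then have "1 \<le> ?h Y"
          using finL by (auto simp: Suc_le_eq card_gt_0_iff)
        then have "1 * (1 / ?b ^ 28 * real (c n N v)) \<le> ?h Y * (1 / ?b ^ 28 * real (c n N v))"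
          by (rule mult_right_mono) simp
        with True show ?thesis
          by (simp add: f2_def)
      qed (simp add: f2_def)
      have "?E (f2 (level N) (Q n N) (c n N) (N v) v) \<le> ?E (\<lambda>Y. ?h Y * (1 / ?b ^ 28 * real (c n N v)))"
        by (intro integral_mono_AE integrable_measure_pmf_finite finite_set_bernoulli_subset AE_I2 f2_le)
      also have "\<dots> = ?E ?h * (1 / ?b ^ 28 * real (c n N v))"
        by simp
      also have "\<dots> \<le> (1 / ?b ^ 32) * (1 / ?b ^ 28 * real (c n N v))"
      proof (rule mult_right_mono)
        have eq: "?E ?h = ?p v * (\<Sum>u\<in>?L. ?p u)"
          using L p v by (intro expectation_edges_bernoulli_subset) auto
        show "?E ?h \<le> 1 / ?b ^ 32"
        proof (cases "v \<in> Q n N")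
          case True
          have "1 \<le> level N v"
            using Q_bad(1)[OF True] by (rule bad_level_pos)
          then have b: "0 < ?b"
            by simp
          have "(\<Sum>u\<in>?L. ?p u) \<le> (\<Sum>u\<in>?L. 1 / ?b ^ 8 * (1 / real (level N u) ^ 17))"
          proof (rule sum_mono)
            fix u
            assume u: "u \<in> ?L"
            have "?p u = 1 / real (level N u) ^ 8 * (1 / real (level N u) ^ 17)"
              using u by (simp add: p_def flip: power_add)
            also have "\<dots> \<le> 1 / ?b ^ 8 * (1 / real (level N u) ^ 17)"
              using u b by (intro mult_right_mono divide_left_mono power_mono) auto
            finally show "?p u \<le> 1 / ?b ^ 8 * (1 / real (level N u) ^ 17)" .
          qed
          also have "\<dots> \<le> 1 / ?b ^ 8 * (\<Sum>u\<in>N v. 1 / real (level N u) ^ 17)"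
            unfolding sum_distrib_left[symmetric]
            by (intro mult_left_mono sum_mono2 graph_on_finite[OF N]) auto
          also have "\<dots> \<le> 1 / ?b ^ 8 * ?b"
            using Q_bad(1)[OF True] by (intro mult_left_mono) (auto simp: bad_def)
          finally have "?p v * (\<Sum>u\<in>?L. ?p u) \<le> ?p v * (1 / ?b ^ 8 * ?b)"
            using p by (intro mult_left_mono) auto
          also have "\<dots> = 1 / ?b ^ 32"
            using b True by (simp add: p_def field_simps power_numeral_reduce)
          finally show ?thesis
            by (simp only: eq)
        next
          case False
          then have "?p v = 0"
            by (simp add: p_def)
          with eq show ?thesis
            by simp
        qed
      qed simp
      also have "\<dots> = 1 / ?b ^ 60 * real (c n N v)"
        by (simp flip: power_add)
      finally show ?thesis .
    qed
    \<comment> \<open>Each selection has at most \<open>k ^ 26\<close> members, and 60 - 26 =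
      34.\<close>
    have "(\<Sum>v<n. 1 / real (level N v) ^ 60 * real (c n N v)) =
      (\<Sum>w<n. \<Sum>k=1..n. \<Sum>x\<in>?T n N w k. 1 / real (level N x) ^ 60 * real (card (?K n N w k)))"
      by (rule sum_c[OF N])
    also have "\<dots> \<le> ?\<Psi>"
    proof (intro sum_mono)
      fix w k
      assume k: "k \<in> {1..n}"
      have "(\<Sum>x\<in>?T n N w k. 1 / real (level N x) ^ 60 * real (card (?K n N w k))) =
        (\<Sum>x\<in>?T n N w k. 1 / real k ^ 60 * real (card (?K n N w k)))"
        using sample_nbrs_subset[of "level N" "Q n N" "N w" k]
        by (intro sum.cong) (auto simp: class_nbrs_def)
      also have "\<dots> = real (card (?T n N w k)) * (1 / real k ^ 60 * real (card (?K n N w k)))"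
        by simp
      also have "\<dots> \<le> real k ^ 26 * (1 / real k ^ 60 * real (card (?K n N w k)))"
      proof (rule mult_right_mono)
        have "card (?T n N w k) \<le> k ^ 26"
          using card_sample_nbrs[of k "level N" "Q n N" "N w"] by (simp add: sample_nbrs_def)
        then show "real (card (?T n N w k)) \<le> real k ^ 26"
          by (metis of_nat_le_iff of_nat_power)
      qed simp
      also have "\<dots> = real (card (?K n N w k)) * (1 / real k ^ 34)"
        using k by (simp add: field_simps flip: power_add)
      finally show "(\<Sum>x\<in>?T n N w k. 1 / real (level N x) ^ 60 * real (card (?K n N w k)))
        \<le> real (card (?K n N w k)) * (1 / real k ^ 34)" .
    qed
    finally have cost2: "(\<Sum>v<n. 1 / real (level N v) ^ 60 * real (c n N v)) \<le> ?\<Psi>" .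
    have "?\<Psi> = (\<Sum>w<n. \<Sum>x\<in>N w \<inter> Q n N. 1 / real (level N x) ^ 34)"
      by (intro sum.cong sum_class_nbrs[OF N]) auto
    also have "\<dots> = (\<Sum>x\<in>Q n N. real (card (N x)) * (1 / real (level N x) ^ 34))"
      by (rule sum_nbrs_swap[OF N Q_sub])
    also have "\<dots> \<le> (\<Sum>x\<in>Q n N. 2 ^ 34)"
    proof (rule sum_mono)
      fix x
      assume "x \<in> Q n N"
      then have "1 \<le> level N x"
        by (intro bad_level_pos Q_bad(1))
      then show "real (card (N x)) * (1 / real (level N x) ^ 34) \<le> 2 ^ 34"
        using card_le_level[of N x] by (simp add: field_simps)
    qed
    also have "\<dots> \<le> 2 ^ 34 * real n"
      using card_mono[OF _ Q_sub[of n N]] by simp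
    finally have \<Psi>: "?\<Psi> \<le> 2 ^ 34 * real n" .
    have "(\<Sum>v<n. ?E (f n (?x n N) (N v) v)) \<le>
      (\<Sum>v<n. 720 * (\<Sum>k=1..n. real (card (?K n N v k)) * (1 / real k ^ 34)) +
        1 / real (level N v) ^ 60 * real (c n N v))"
      unfolding f_def prod.case expectation_add_bernoulli_subset
      by (intro sum_mono add_mono E1 E2) auto
    also have "\<dots> = 720 * ?\<Psi> + (\<Sum>v<n. 1 / real (level N v) ^ 60 * real (c n N v))"
      by (simp only: sum.distrib sum_distrib_left)
    also have "\<dots> \<le> 721 * 2 ^ 34 * real n"
      using cost2 \<Psi> by linarith
    finally show "(\<Sum>v<n. measure_pmf.expectation (D n (?x n N)) (f n (?x n N) (N v) v)) \<le> 721 * 2 ^ 34 * real n"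
      unfolding D_def prod.case .
  qed

  \<comment> \<open>The chosen set and the weight of the bad vertices left unruled\<close>
  then obtain Y C where Y: "computable (\<lambda>n N. (?x n N, Y n N))"
    and Y_all: "\<forall>n N. graph_on n N \<longrightarrow> Y n N \<in> set_pmf (D n (?x n N)) \<and>
      (\<Sum>v<n. f n (?x n N) (N v) v (Y n N)) \<le> C * real n"
    by (elim exE conjE)
  have Y_sub: "Y n N \<subseteq> Q n N" if "graph_on n N" for n N
  proof
    fix u
    assume u: "u \<in> Y n N"
    have "Y n N \<in> set_pmf (bernoulli_subset n (p (level N) (Q n N)))"
      using Y_all that by (simp add: D_def)
    from bernoulli_subset_support(2)[OF this u] show "u \<in> Q n N"
      by (simp add: p_def split: if_splits)
  qed
  define I where "I = (\<lambda>n N. {v. v < n \<and> (v \<in> Y n N \<and> \<not> killed (level N) (Q n N) (N v) v (Y n N))})"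
  have "computable (\<lambda>n N. ((?x n N, Y n N), I n N))"
    using computable_flags[OF Y, of "\<lambda>n (((((b, B), m), q), c), y) A v. v \<in> y \<and> \<not> killed b q A v y"]
    unfolding I_def by (simp only: prod.case)
  then have "computable (\<lambda>n N. (\<lambda>n ((((((b, B), m), q), c), y), i). ((b, B), m \<union> i)) n ((?x n N, Y n N), I n N))"
    by (rule computable_map)
  then have comp: "computable (\<lambda>n N. ((level N, bad N), M n N \<union> I n N))"
    by (simp only: prod.case)
  have "M n N \<union> I n N \<subseteq> {..<n} \<and> independent_in N (M n N \<union> I n N) \<and>
    (\<Sum>v\<in>bad N \<inter> far n N (M n N \<union> I n N). real (level N v) ^ 6) \<le> (2 + C) * real n"
    if N: "graph_on n N" for n N
  proof (intro conjI)
    show "M n N \<union> I n N \<subseteq> {..<n}"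
      using M'[OF N] by (auto simp: I_def)
    have I_sub: "I n N \<subseteq> Q n N"
      using Y_sub[OF N] by (auto simp: I_def)
    have "independent_in N (I n N)"
      unfolding independent_in_def
    proof (intro ballI equals0I)
      fix v w
      assume v: "v \<in> I n N" and w: "w \<in> N v \<inter> I n N"
      have "v \<in> Q n N" "w \<in> Q n N" "v \<in> Y n N" "w \<in> Y n N" "v \<in> N w"
        using v w I_sub N by (auto simp: I_def graph_on_def)
      then show False
        using v w linear[of "level N v" "level N w"] by (auto simp: I_def killed_def)
    qed
    then show "independent_in N (M n N \<union> I n N)"
      using M'[OF N] I_sub by (intro independent_in_Un_far[OF N]) (auto simp: Q_def)
    define R where "R = bad N \<inter> far n N (M n N \<union> I n N)"
    let ?kill = "\<lambda>x. if killed (level N) (Q n N) (N x) x (Y n N) then 1 / real (level N x) ^ 28 else 0"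
    have R_sub: "R \<subseteq> Q n N"
      unfolding R_def Q_def using far_antimono[of "M n N" "M n N \<union> I n N" n N] by blast
    \<comment> \<open>If any of the class \<open>k\<close> around \<open>w\<close> is left, its
      weight is paid for in one of three ways: the class is small, no selected vertex is sampled, or
      a sampled one is killed. Small classes pay \<open>k ^ 26 / k ^ 28\<close>, a convergent
      series.\<close>
    have charge: "real (card (class_nbrs (level N) R (N w) k)) * (1 / real k ^ 28) \<le>
        1 / real k ^ 2 + f0 (level N) (Q n N) (N w) k (Y n N) + (\<Sum>x\<in>?T n N w k. ?kill x * real (card (?K n N w k)))"
      if k: "k \<in> {1..n}" for w k
    proof -
      let ?r = "real (card (class_nbrs (level N) R (N w) k))" and ?q = "real (card (?K n N w k))"
      have "class_nbrs (level N) R (N w) k \<subseteq> ?K n N w k"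
        using R_sub by (auto simp: class_nbrs_def)
      then have r_le: "?r \<le> ?q"
        using K(1)[OF N] by (simp add: card_mono)
      have kill_nonneg: "0 \<le> (\<Sum>x\<in>?T n N w k. ?kill x * ?q)"
        by (intro sum_nonneg) auto
      have sq_nonneg: "0 \<le> 1 / real k ^ 2"
        by simp
      consider "card (?K n N w k) < k ^ 26" | "class_nbrs (level N) R (N w) k = {}"
        | "k ^ 26 \<le> card (?K n N w k)" "class_nbrs (level N) R (N w) k \<noteq> {}"
        by linarith
      then show ?thesis
      proof cases
        case 1
        then have "?q \<le> real k ^ 26"
          by (metis less_imp_le of_nat_le_iff of_nat_power)
        then have "?r * (1 / real k ^ 28) \<le> real k ^ 26 * (1 / real k ^ 28)"
          using r_le by (intro mult_right_mono) auto
        also have "\<dots> = 1 / real k ^ 2"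
          using k by (simp add: field_simps flip: power_add)
        finally show ?thesis
          using kill_nonneg f0_nonneg[of "level N" "Q n N" "N w" k "Y n N"] by linarith
      next
        case 2
        then show ?thesis
          using kill_nonneg f0_nonneg[of "level N" "Q n N" "N w" k "Y n N"] by simp
      next
        case 3
        have le_q: "?r * (1 / real k ^ 28) \<le> ?q * (1 / real k ^ 28)"
          using r_le by (intro mult_right_mono) auto
        show ?thesis
        proof (cases "?T n N w k \<inter> Y n N = {}")
          case True
          then have "f0 (level N) (Q n N) (N w) k (Y n N) = ?q * (1 / real k ^ 28)"
            using 3(1) by (simp add: f0_def)
          then show ?thesis
            using le_q kill_nonneg sq_nonneg by linarith
        next
          case False
          then obtain x where x: "x \<in> ?T n N w k" "x \<in> Y n N"
            by blast
          obtain u where "u \<in> R" "u \<in> N w"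
            using 3(2) by (auto simp: class_nbrs_def)
          \<comment> \<open>A neighbour of \<open>w\<close> in the new set would rule
            \<open>u\<close> within distance two. So the sampled \<open>x\<close> was not taken,
            which means that it was killed.\<close>
          then have "N w \<inter> I n N = {}"
            using N by (auto simp: R_def far_def graph_on_def)
          moreover have xK: "x \<in> N w" "x \<in> Q n N" "level N x = k"
            using x(1) sample_nbrs_subset[of "level N" "Q n N" "N w" k] by (auto simp: class_nbrs_def)
          ultimately have "killed (level N) (Q n N) (N x) x (Y n N)"
            using x(2) Q_bad(2)[of x n N] by (auto simp: I_def)
          then have "?q * (1 / real k ^ 28) = ?kill x * ?q"
            using xK by simp
          also have "\<dots> \<le> (\<Sum>x\<in>?T n N w k. ?kill x * ?q)"
            using x(1) finite_subset[OF sample_nbrs_subset K(1)[OF N]] by (intro member_le_sum) auto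
          finally show ?thesis
            using le_q f0_nonneg[of "level N" "Q n N" "N w" k "Y n N"] sq_nonneg
            by linarith
        qed
      qed
    qed
    have "(\<Sum>v\<in>R. real (level N v) ^ 6) \<le> (\<Sum>v\<in>R. real (card (N v)) * (1 / real (level N v) ^ 28))"
    proof (rule sum_mono)
      fix v
      assume "v \<in> R"
      then have b: "1 \<le> level N v"
        by (intro bad_level_pos) (simp add: R_def)
      have "real (level N v ^ 34) \<le> real (card (N v))"
        unfolding level_def by (intro of_nat_mono degree_scale_power_le)
      then have "real (level N v) ^ 34 * (1 / real (level N v) ^ 28) \<le> real (card (N v)) * (1 / real (level N v) ^ 28)"
        by (intro mult_right_mono) auto
      moreover have "real (level N v) ^ 34 * (1 / real (level N v) ^ 28) = real (level N v) ^ 6"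
        using b by (simp add: field_simps flip: power_add)
      ultimately show "real (level N v) ^ 6 \<le> real (card (N v)) * (1 / real (level N v) ^ 28)"
        by simp
    qed
    also have "\<dots> = (\<Sum>w<n. \<Sum>x\<in>N w \<inter> R. 1 / real (level N x) ^ 28)"
      using R_sub Q_sub[of n N] by (intro sum_nbrs_swap[OF N, symmetric]) blast
    also have "\<dots> = (\<Sum>w<n. \<Sum>k=1..n. real (card (class_nbrs (level N) R (N w) k)) * (1 / real k ^ 28))"
      by (intro sum.cong sum_class_nbrs[OF N, symmetric]) auto
    also have "\<dots> \<le> (\<Sum>w<n. \<Sum>k=1..n. 1 / real k ^ 2 + f0 (level N) (Q n N) (N w) k (Y n N) +
        (\<Sum>x\<in>?T n N w k. ?kill x * real (card (?K n N w k))))"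
      by (intro sum_mono charge)
    also have "\<dots> = (\<Sum>w<n. \<Sum>k=1..n. 1 / real k ^ 2) + (\<Sum>w<n. f1 n (level N) (Q n N) (N w) (Y n N)) +
        (\<Sum>x<n. ?kill x * real (c n N x))"
      by (simp only: sum.distrib f1_def sum_c[OF N])
    also have "(\<Sum>x<n. ?kill x * real (c n N x)) = (\<Sum>x<n. f2 (level N) (Q n N) (c n N) (N x) x (Y n N))"
      by (intro sum.cong) (auto simp: f2_def)
    also have "(\<Sum>w<n. \<Sum>k=1..n. 1 / real k ^ 2) + (\<Sum>w<n. f1 n (level N) (Q n N) (N w) (Y n N)) +
        (\<Sum>x<n. f2 (level N) (Q n N) (c n N) (N x) x (Y n N)) =
        (\<Sum>w<n. \<Sum>k=1..n. 1 / real k ^ 2) + (\<Sum>v<n. f n (?x n N) (N v) v (Y n N))"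
      by (simp add: f_def sum.distrib)
    also have "\<dots> \<le> (\<Sum>w<n. 2) + C * real n"
      using Y_all N by (intro add_mono sum_mono sum_inverse_squares_le) blast
    finally show "(\<Sum>v\<in>bad N \<inter> far n N (M n N \<union> I n N). real (level N v) ^ 6) \<le> (2 + C) * real n"
      by (simp add: R_def algebra_simps)
  qed
  then show ?thesis
    using comp by (intro exI[of _ "\<lambda>n N. M n N \<union> I n N"] exI[of _ "2 + C"]) blast
qed

section \<open>The ruling set\<close>

lemma graph_dist_le_two:
  assumes "pair_graph G" and v: "v \<in> pverts G"
    and s: "s = v \<or> (v, s) \<in> parcs G \<or> (\<exists>w. (v, w) \<in> parcs G \<and> (w, s) \<in> parcs G)"
  shows "graph_dist G v s \<le> 2"
proof -
  interpret pair_graph G by fact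
  have walk: "graph_dist G v s \<le> 2" if "awalk v q s" "length q \<le> 2" for q
  proof -
    have "awalk_cost (\<lambda>_. 1) q = real (length q)"
      by (induction q) auto
    then have "graph_dist G v s \<le> ereal (real (length q))"
      using min_cost_le_walk_cost[OF that(1), of "\<lambda>_. 1"] by (simp add: graph_dist_def)
    also have "\<dots> \<le> 2"
      using that(2) by simp
    finally show ?thesis .
  qed
  from s consider "s = v" | "(v, s) \<in> parcs G"
    | w where "(v, w) \<in> parcs G" "(w, s) \<in> parcs G"
    by blast
  then show ?thesis
  proof cases
    case 1
    then show ?thesis
      using v by (intro walk[of "[]"]) (auto simp: awalk_Nil_iff)
  next
    case 2
    then show ?thesis
      using in_arcsD2 by (intro walk[of "[(v, s)]"]) (auto simp: awalk_Cons_iff awalk_Nil_iff)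
  next
    case 3
    then show ?thesis
      using in_arcsD2 by (intro walk[of "[(v, w), (w, s)]"]) (auto simp: awalk_Cons_iff awalk_Nil_iff)
  qed
qed

theorem theorem12:
  shows "\<exists>A :: nat cc_algorithm.
           cc_log_bandwidth A \<and> cc_finds A two_ruling_set \<and> cc_constant_rounds_whp A"
proof -
  obtain M1 C1 where M1: "computable (\<lambda>n N. ((level N, bad N), M1 n N))"
    "\<And>n N. graph_on n N \<Longrightarrow> M1 n N \<subseteq> {..<n} \<and> independent_in N (M1 n N) \<and>
      (\<Sum>v\<in>far n N (M1 n N) - bad N. real (card (N v))) \<le> C1 * real n"
    using stage_one by blast
  obtain M2 C2 where M2: "computable (\<lambda>n N. ((level N, bad N), M2 n N))"
    "\<And>n N. graph_on n N \<Longrightarrow> M1 n N \<subseteq> M2 n N \<and> M2 n N \<subseteq> {..<n} \<and> independent_in N (M2 n N) \<and>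
      (\<Sum>v\<in>bad N \<inter> far n N (M2 n N). real (level N v) ^ 6) \<le> C2 * real n"
    using stage_two[OF M1(1)] M1(2) by blast
  obtain M3 C3 where M3: "computable (\<lambda>n N. ((level N, bad N), M3 n N))"
    "\<And>n N. graph_on n N \<Longrightarrow> M2 n N \<subseteq> M3 n N \<and> M3 n N \<subseteq> {..<n} \<and> independent_in N (M3 n N) \<and>
      (\<Sum>v\<in>bad N \<inter> far n N (M3 n N).
        real (card {u \<in> N v \<inter> (bad N \<inter> far n N (M3 n N)). level N u \<le> level N v})) \<le> C3 * real n"
    using stage_three[OF M2(1)] M2(2) by blast
  \<comment> \<open>The bound of the first stage persists, since \<open>far\<close> shrinks as the
    independent set grows.\<close>
  have "(\<Sum>v\<in>far n N (M3 n N) - bad N. real (card (N v))) \<le> C1 * real n" if N: "graph_on n N" for n N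
  proof -
    have "far n N (M3 n N) \<subseteq> far n N (M1 n N)"
      using M2(2)[OF N] M3(2)[OF N] by (intro far_antimono) blast
    then have "(\<Sum>v\<in>far n N (M3 n N) - bad N. real (card (N v))) \<le>
      (\<Sum>v\<in>far n N (M1 n N) - bad N. real (card (N v)))"
      by (intro sum_mono2) (auto simp: finite_far)
    then show ?thesis
      using M1(2)[OF N] by linarith
  qed
  then obtain S where S: "computable (\<lambda>n N. S n N)"
    "\<And>n N. graph_on n N \<Longrightarrow> S n N \<subseteq> {..<n} \<and> independent_in N (S n N) \<and> far n N (S n N) = {}"
    using stage_four[OF M3(1)] M3(2) by blast
  have "two_ruling_set G (S n (\<lambda>v. {u. (v, u) \<in> parcs G}) \<inter> {..<n})" if input: "cc_input n G" for n G
  proof -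
    let ?N = "\<lambda>v. {u. (v, u) \<in> parcs G}"
    let ?S = "S n ?N"
    have G: "pair_graph G" "pverts G = {..<n}"
      using input by (auto simp: cc_input_def)
    have *: "?S \<subseteq> {..<n}" "independent_in ?N ?S" "far n ?N ?S = {}"
      using S(2)[OF graph_on_input[OF input refl]] by auto
    have "\<exists>s\<in>?S. graph_dist G v s \<le> 2" if v: "v < n" for v
    proof -
      have "v \<notin> far n ?N ?S"
        using *(3) by simp
      then have "\<exists>s\<in>?S. s = v \<or> (v, s) \<in> parcs G \<or> (\<exists>w. (v, w) \<in> parcs G \<and> (w, s) \<in> parcs G)"
        using v by (auto simp: far_def)
      then show ?thesis
        using graph_dist_le_two[OF G(1)] G(2) v by auto
    qed
    then show ?thesis
      using *(1,2) G(2) by (auto simp: two_ruling_set_def independent_in_def Int_absorb2)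
  qed
  then show ?thesis
    by (rule compile_correct[OF S(1)])
qed

end
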